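(* Let $(W,S)$ be a Coxeter system with $S$ finite and let $c\in W$ be a Coxeter element. The three following maps are order-preserving and injective: (1) the map $[1,c]_T \to \mathrm{Sub}(V)$, $x\mapsto \mathsf{AM}(x)$; (2) the map $[1,c]_T \to \mathrm{RS}(W)$, $x\mapsto P(x)$; (3) the map $[1,c]_T \to \mathcal{P}(T)$, $x\mapsto T(x)$.
   Context: $T=\bigcup_{w\in W} wSw^{-1}$ is the set of reflections of $W$. The reflection length $\ell_T(w)$ is the smallest $k\ge 0$ such that $w$ is a product of $k$ elements of $T$. The absolute order is the partial order on $W$ defined by $u\leq_T v \iff \ell_T(u)+\ell_T(u^{-1}v)=\ell_T(v)$. A Coxeter element is a product of all the elements of $S$, each occurring exactly once, in some order. $[1,c]_T=\{x\in W\mid x\leq_T c\}$, ordered by $\leq_T$. $V$ is the geometric representation of $W$: the real vector space with basis $\{\alpha_s\}_{s\in S}$, with symmetric bilinear form $B$ given by $B(\alpha_s,\alpha_{s'})=-\cos(\pi/m_{ss'})$ (equal to $-1$ if $m_{ss'}=\infty$), on which $s\in S$ acts by $s(v)=v-2B(\alpha_s,v)\alpha_s$. The root system is $\Phi=\{w(\alpha_s)\mid w\in W, s\in S\}=\Phi^+\sqcup\Phi^-$; for $t\in T$, $\alpha_t\in\Phi^+$ denotes the unique positive root such that $t(v)=v-2B(\alpha_t,v)\alpha_t$ for all $v \in V$. For $x\in[1,c]_T$: $T(x)=\{t\in T\mid t\leq_T x\}$; $P(x)$ is the subgroup of $W$ generated by $T(x)$; and $\mathsf{AM}(x)=\sum_{t\in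 T(x)}\mathbb{R}\alpha_t\subseteq V$ (the absolute moved space of $x$). $\mathrm{Sub}(V)$ is the set of linear subspaces of $V$; $\mathrm{RS}(W)$ is the set of reflection subgroups of $W$, i.e. subgroups generated by a subset of $T$; $\mathcal{P}(T)$ is the set of subsets of $T$. All three are partially ordered by inclusion. *)

theory Defs
  imports "HOL-Analysis.Analysis" "HOL-Algebra.Multiplicative_Group" "HOL-Algebra.Generated_Groups"
begin

section \<open>Coxeter systems\<close>

definition word_prod :: "('a, 'b) monoid_scheme \<Rightarrow> 'a list \<Rightarrow> 'a"
  where "word_prod W ws = foldr (\<otimes>\<^bsub>W\<^esub>) ws \<one>\<^bsub>W\<^esub>"

text \<open>The Coxeter matrix. By the convention of \<^const>\<open>group.ord\<close>, the value \<open>0\<close> encodes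
  \<open>m\<^sub>s\<^sub>t = \<infinity>\<close>.\<close>

definition cox_m :: "('a, 'b) monoid_scheme \<Rightarrow> 'a \<Rightarrow> 'a \<Rightarrow> nat"
  where "cox_m W s t = group.ord W (s \<otimes>\<^bsub>W\<^esub> t)"

text \<open>The congruence on the free monoid of words over \<open>S\<close> generated by \<open>(s t)\<^sup>m = 1\<close>, with
  \<open>m = m\<^sub>s\<^sub>t\<close>. For \<open>m\<^sub>s\<^sub>t = \<infinity>\<close> the clause \<open>rel\<close> is void. For \<open>s = t\<close> it is \<open>s s = 1\<close>; hence
  every generator is its own formal inverse, and the quotient monoid is the group with
  generators \<open>S\<close> and these relations.\<close>

inductive cox_eq :: "('a, 'b) monoid_scheme \<Rightarrow> 'a set \<Rightarrow> 'a list \<Rightarrow> 'a list \<Rightarrow> bool"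
  for W S where
  refl: "u \<in> lists S \<Longrightarrow> cox_eq W S u u"
| sym: "cox_eq W S u v \<Longrightarrow> cox_eq W S v u"
| trans: "cox_eq W S u v \<Longrightarrow> cox_eq W S v w \<Longrightarrow> cox_eq W S u w"
| rel: "\<lbrakk>u \<in> lists S; v \<in> lists S; s \<in> S; t \<in> S\<rbrakk>
    \<Longrightarrow> cox_eq W S (u @ concat (replicate (cox_m W s t) [s, t]) @ v) (u @ v)"

text \<open>\<open>(W, S)\<close> is a Coxeter system: \<open>S\<close> generates \<open>W\<close>, consists of involutions, and the
  relations \<open>(s t)\<^sup>m = 1\<close> form a presentation of \<open>W\<close>. (That words congruent under
  \<^const>\<open>cox_eq\<close> have the same product holds in any group generated by involutions, so only the
  converse is required.)\<close>

definition coxeter_system :: "('a, 'b) monoid_scheme \<Rightarrow> 'a set \<Rightarrow> bool"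
  where "coxeter_system W S \<longleftrightarrow>
    group W \<and> S \<subseteq> carrier W \<and> generate W S = carrier W \<and>
    (\<forall>s\<in>S. group.ord W s = 2) \<and>
    (\<forall>u\<in>lists S. \<forall>v\<in>lists S. word_prod W u = word_prod W v \<longrightarrow> cox_eq W S u v)"

definition coxeter_element :: "('a, 'b) monoid_scheme \<Rightarrow> 'a set \<Rightarrow> 'a \<Rightarrow> bool"
  where "coxeter_element W S c \<longleftrightarrow> (\<exists>ss. distinct ss \<and> set ss = S \<and> c = word_prod W ss)"


section \<open>Reflections and the absolute order\<close>

definition reflections :: "('a, 'b) monoid_scheme \<Rightarrow> 'a set \<Rightarrow> 'a set"
  where "reflections W S = {w \<otimes>\<^bsub>W\<^esub> s \<otimes>\<^bsub>W\<^esub> inv\<^bsub>W\<^esub> w | w s. w \<in> carrier W \<and> s \<in> S}"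

definition refl_length :: "('a, 'b) monoid_scheme \<Rightarrow> 'a set \<Rightarrow> 'a \<Rightarrow> nat"
  where "refl_length W S w =
    (LEAST k. \<exists>ts \<in> lists (reflections W S). length ts = k \<and> word_prod W ts = w)"

definition abs_le :: "('a, 'b) monoid_scheme \<Rightarrow> 'a set \<Rightarrow> 'a \<Rightarrow> 'a \<Rightarrow> bool"
  where "abs_le W S u v \<longleftrightarrow>
    refl_length W S u + refl_length W S (inv\<^bsub>W\<^esub> u \<otimes>\<^bsub>W\<^esub> v) = refl_length W S v"

definition abs_interval :: "('a, 'b) monoid_scheme \<Rightarrow> 'a set \<Rightarrow> 'a \<Rightarrow> 'a set"
  where "abs_interval W S c = {x \<in> carrier W. abs_le W S x c}"

definition refl_subgroups :: "('a, 'b) monoid_scheme \<Rightarrow> 'a set \<Rightarrow> 'a set set"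
  where "refl_subgroups W S = {generate W A | A. A \<subseteq> reflections W S}"

definition refl_below :: "('a, 'b) monoid_scheme \<Rightarrow> 'a set \<Rightarrow> 'a \<Rightarrow> 'a set"
  where "refl_below W S x = {t \<in> reflections W S. abs_le W S t x}"

definition par_subgroup :: "('a, 'b) monoid_scheme \<Rightarrow> 'a set \<Rightarrow> 'a \<Rightarrow> 'a set"
  where "par_subgroup W S x = generate W (refl_below W S x)"


section \<open>The geometric representation\<close>

text \<open>The type \<open>'v\<close>, taken whole, is the vector space \<open>V\<close> with basis \<open>(\<alpha> s)\<close> for \<open>s \<in> S\<close>;
  the values of \<open>\<alpha>\<close> outside \<open>S\<close> are irrelevant.\<close>

definition simple_root_basis :: "'a set \<Rightarrow> ('a \<Rightarrow> 'v::real_vector) \<Rightarrow> bool"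
  where "simple_root_basis S \<alpha> \<longleftrightarrow>
    inj_on \<alpha> S \<and> independent (\<alpha> ` S) \<and> span (\<alpha> ` S) = UNIV"

definition coord :: "'a set \<Rightarrow> ('a \<Rightarrow> 'v::real_vector) \<Rightarrow> 'v \<Rightarrow> 'a \<Rightarrow> real"
  where "coord S \<alpha> v s = representation (\<alpha> ` S) v (\<alpha> s)"

definition gram :: "('a, 'b) monoid_scheme \<Rightarrow> 'a \<Rightarrow> 'a \<Rightarrow> real"
  where "gram W s t = (if cox_m W s t = 0 then - 1 else - cos (pi / real (cox_m W s t)))"

text \<open>The sum is meaningful for finite \<open>S\<close> only.\<close>

definition cox_form ::
    "('a, 'b) monoid_scheme \<Rightarrow> 'a set \<Rightarrow> ('a \<Rightarrow> 'v::real_vector) \<Rightarrow> 'v \<Rightarrow> 'v \<Rightarrow> real"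
  where "cox_form W S \<alpha> u v = (\<Sum>s\<in>S. \<Sum>t\<in>S. coord S \<alpha> u s * coord S \<alpha> v t * gram W s t)"

definition root_reflection ::
    "('a, 'b) monoid_scheme \<Rightarrow> 'a set \<Rightarrow> ('a \<Rightarrow> 'v::real_vector) \<Rightarrow> 'v \<Rightarrow> 'v \<Rightarrow> 'v"
  where "root_reflection W S \<alpha> \<beta> v = v - (2 * cox_form W S \<alpha> \<beta> v) *\<^sub>R \<beta>"

definition word_act ::
    "('a, 'b) monoid_scheme \<Rightarrow> 'a set \<Rightarrow> ('a \<Rightarrow> 'v::real_vector) \<Rightarrow> 'a list \<Rightarrow> 'v \<Rightarrow> 'v"
  where "word_act W S \<alpha> ws = foldr (\<lambda>s f. root_reflection W S \<alpha> (\<alpha> s) \<circ> f) ws id"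

text \<open>The action of \<open>w\<close> is that of any word in \<open>S\<close> representing \<open>w\<close>. Independence of the word
  is proved below, in \<open>geom_act_word_prod\<close>; by \<open>geom_act_one\<close>, \<open>geom_act_mult\<close> and
  \<open>geom_act_simple\<close> this is the group action in which each \<open>s \<in> S\<close> acts by its reflection.\<close>

definition geom_act ::
    "('a, 'b) monoid_scheme \<Rightarrow> 'a set \<Rightarrow> ('a \<Rightarrow> 'v::real_vector) \<Rightarrow> 'a \<Rightarrow> 'v \<Rightarrow> 'v"
  where "geom_act W S \<alpha> w =
    (THE f. \<exists>ws\<in>lists S. word_prod W ws = w \<and> f = word_act W S \<alpha> ws)"

definition roots :: "('a, 'b) monoid_scheme \<Rightarrow> 'a set \<Rightarrow> ('a \<Rightarrow> 'v::real_vector) \<Rightarrow> 'v set"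
  where "roots W S \<alpha> = {geom_act W S \<alpha> w (\<alpha> s) | w s. w \<in> carrier W \<and> s \<in> S}"

definition pos_roots :: "('a, 'b) monoid_scheme \<Rightarrow> 'a set \<Rightarrow> ('a \<Rightarrow> 'v::real_vector) \<Rightarrow> 'v set"
  where "pos_roots W S \<alpha> = {\<beta> \<in> roots W S \<alpha>. \<forall>s\<in>S. coord S \<alpha> \<beta> s \<ge> 0}"

definition refl_root ::
    "('a, 'b) monoid_scheme \<Rightarrow> 'a set \<Rightarrow> ('a \<Rightarrow> 'v::real_vector) \<Rightarrow> 'a \<Rightarrow> 'v"
  where "refl_root W S \<alpha> t =
    (THE \<beta>. \<beta> \<in> pos_roots W S \<alpha> \<and> geom_act W S \<alpha> t = root_reflection W S \<alpha> \<beta>)"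

definition abs_moved_space ::
    "('a, 'b) monoid_scheme \<Rightarrow> 'a set \<Rightarrow> ('a \<Rightarrow> 'v::real_vector) \<Rightarrow> 'a \<Rightarrow> 'v set"
  where "abs_moved_space W S \<alpha> x = span (refl_root W S \<alpha> ` refl_below W S x)"


section \<open>The geometric representation is well defined\<close>

lemma word_prod_simps [simp]:
  "word_prod W [] = \<one>\<^bsub>W\<^esub>" "word_prod W (x # xs) = x \<otimes>\<^bsub>W\<^esub> word_prod W xs"
  by (simp_all add: word_prod_def)

lemma word_prod_closed: "group W \<Longrightarrow> set u \<subseteq> carrier W \<Longrightarrow> word_prod W u \<in> carrier W"
  by (induction u) (auto simp: group.is_monoid monoid.m_closed)

lemma word_prod_append:
  assumes "group W" "set u \<subseteq> carrier W" "set v \<subseteq> carrier W"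
  shows "word_prod W (u @ v) = word_prod W u \<otimes>\<^bsub>W\<^esub> word_prod W v"
proof -
  interpret group W by fact
  show ?thesis using assms by (induction u) (auto simp: m_assoc word_prod_closed)
qed

lemma word_act_simps [simp]:
  "word_act W S \<alpha> [] = id"
  "word_act W S \<alpha> (s # u) = root_reflection W S \<alpha> (\<alpha> s) \<circ> word_act W S \<alpha> u"
  by (simp_all add: word_act_def)

lemma word_act_append: "word_act W S \<alpha> (u @ v) = word_act W S \<alpha> u \<circ> word_act W S \<alpha> v"
  by (induction u) (auto simp: o_assoc)

lemma word_act_power:
  "word_act W S \<alpha> (concat (replicate n [s, t])) =
    (root_reflection W S \<alpha> (\<alpha> s) \<circ> root_reflection W S \<alpha> (\<alpha> t)) ^^ n"
  by (induction n) (auto simp: o_assoc)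

lemma dihedral_step:
  fixes a b c s C X p q p' q' :: real
  assumes cs: "c^2 = 1 - s^2" "C^2 = 1 - X^2" and s: "s \<noteq> 0"
    and q: "q * s^2 = b * X^2 + a * X * (X * c - C * s)"
    and p: "p * s^2 = b * X * (X * c + C * s) + a * X^2"
    and q': "q' * s^2 = b * (X * c + C * s)^2 + a * (X * c + C * s) * X"
    and p': "p' * s^2 = b * (X * c + C * s) * (X * (1 - 2 * s^2) + 2 * C * s * c)
      + a * (X * c + C * s)^2"
  shows "q' = b - q + 2 * c * p" "p' = a - p - 2 * c * q + 2 * c * b + 4 * c^2 * p"
proof -
  have sq: "(X * c + C * s)^2 = s^2 - X^2 + 2 * c * X * (X * c + C * s)"
  proof -
    have "(X * c + C * s)^2 = 2 * c * X * (X * c + C * s) + C^2 * s^2 - X^2 * c^2"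
      by (simp add: power2_eq_square algebra_simps)
    then show ?thesis by (simp add: cs algebra_simps)
  qed
  have "q' * s^2 = (b - q + 2 * c * p) * s^2"
  proof -
    have "(b - q + 2 * c * p) * s^2 = b * s^2 - q * s^2 + 2 * c * (p * s^2)"
      by (simp add: algebra_simps)
    also have "\<dots> = b * (s^2 - X^2 + 2 * c * X * (X * c + C * s)) + a * (X * c + C * s) * X"
      unfolding q p by (simp add: algebra_simps power2_eq_square)
    finally show ?thesis by (simp add: q' sq)
  qed
  then show q1: "q' = b - q + 2 * c * p" using s by simp
  have "p' * s^2 = (2 * c * q' + a - p) * s^2"
  proof -
    have "X * (1 - 2 * s^2) + 2 * C * s * c = 2 * c * (X * c + C * s) - X"
    proof -
      have "1 - 2 * s^2 = 2 * c^2 - 1" using cs(1) by simp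
      then show ?thesis by (simp only:) (simp add: algebra_simps power2_eq_square)
    qed
    then have "p' * s^2 = b * (X * c + C * s) * (2 * c * (X * c + C * s) - X)
        + a * (s^2 - X^2 + 2 * c * X * (X * c + C * s))"
      by (simp only: p' sq)
    moreover have "(2 * c * q' + a - p) * s^2 = 2 * c * (q' * s^2) + a * s^2 - p * s^2"
      by (simp add: algebra_simps)
    ultimately show ?thesis
      unfolding q' p by (simp add: algebra_simps power2_eq_square)
  qed
  then have "p' = 2 * c * q' + a - p" using s by simp
  then show "p' = a - p - 2 * c * q + 2 * c * b + 4 * c^2 * p"
    unfolding q1 by (simp add: algebra_simps power2_eq_square)
qed

lemma dihedral_power:
  fixes a b :: "'v::real_vector" and B :: "'v \<Rightarrow> 'v \<Rightarrow> real" and \<theta> :: real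
  assumes lin: "linear (B a)" "linear (B b)"
    and 1: "B a a = 1" "B b b = 1" and ab: "B a b = - cos \<theta>" "B b a = - cos \<theta>"
    and s: "sin \<theta> \<noteq> 0"
  defines "f \<equiv> (\<lambda>v. v - (2 * B a v) *\<^sub>R a) \<circ> (\<lambda>v. v - (2 * B b v) *\<^sub>R b)"
  shows "(f ^^ n) v = v
    - (2 * ((B b v * (sin (n*\<theta>))^2 + B a v * sin (n*\<theta>) * sin (n*\<theta> - \<theta>)) / (sin \<theta>)^2)) *\<^sub>R b
    - (2 * ((B b v * sin (n*\<theta>) * sin (n*\<theta> + \<theta>) + B a v * (sin (n*\<theta>))^2) / (sin \<theta>)^2)) *\<^sub>R a"
proof (induction n)
  case 0
  show ?case by simp
next
  case (Suc n)
  define q where "q = (\<lambda>x. (B b v * (sin x)^2 + B a v * sin x * sin (x - \<theta>)) / (sin \<theta>)^2)"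
  define p where "p = (\<lambda>x. (B b v * sin x * sin (x + \<theta>) + B a v * (sin x)^2) / (sin \<theta>)^2)"
  define x where "x = real n * \<theta>"
  have step: "f (v - (2*q0) *\<^sub>R b - (2*p0) *\<^sub>R a) =
      v - (2 * (B b v - q0 + 2 * cos \<theta> * p0)) *\<^sub>R b
        - (2 * (B a v - p0 - 2 * cos \<theta> * q0 + 2 * cos \<theta> * B b v + 4 * (cos \<theta>)^2 * p0)) *\<^sub>R a"
    for q0 p0
    using lin 1 ab
    by (simp add: f_def linear_diff linear_add linear_scale algebra_simps power2_eq_square
        flip: scaleR_add_left scaleR_diff_left)
  have sc: "(cos \<theta>)^2 = 1 - (sin \<theta>)^2" "(cos x)^2 = 1 - (sin x)^2"
    by (simp_all add: cos_squared_eq)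
  have s1: "sin (x + \<theta>) = sin x * cos \<theta> + cos x * sin \<theta>"
    "sin (x - \<theta>) = sin x * cos \<theta> - cos x * sin \<theta>"
    by (simp_all add: sin_add sin_diff)
  have s2: "sin (x + \<theta> + \<theta>) = sin x * (1 - 2 * (sin \<theta>)^2) + 2 * cos x * sin \<theta> * cos \<theta>"
  proof -
    have "sin (x + \<theta> + \<theta>) = sin x * ((cos \<theta>)^2 - (sin \<theta>)^2) + 2 * cos x * sin \<theta> * cos \<theta>"
      unfolding sin_add[of "x + \<theta>"] cos_add sin_add[of x]
      by (simp add: algebra_simps power2_eq_square)
    then show ?thesis by (simp add: sc(1))
  qed
  have mult: "q y * (sin \<theta>)^2 = B b v * (sin y)^2 + B a v * sin y * sin (y - \<theta>)"
    "p y * (sin \<theta>)^2 = B b v * sin y * sin (y + \<theta>) + B a v * (sin y)^2" for y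
    using s by (simp_all add: q_def p_def)
  note step' = dihedral_step[OF sc s mult[of x, unfolded s1]
      mult[of "x + \<theta>", unfolded s2, unfolded s1 add_diff_cancel_right']]
  have "(f ^^ Suc n) v = f (v - (2 * q x) *\<^sub>R b - (2 * p x) *\<^sub>R a)"
    using Suc by (simp add: q_def p_def x_def)
  also have "\<dots> = v - (2 * q (x + \<theta>)) *\<^sub>R b - (2 * p (x + \<theta>)) *\<^sub>R a"
    by (simp add: step step')
  also have "x + \<theta> = real (Suc n) * \<theta>"
    by (simp add: x_def algebra_simps)
  finally show ?case by (simp add: q_def p_def)
qed

context
  fixes W :: "('a, 'b) monoid_scheme" and S :: "'a set" and \<alpha> :: "'a \<Rightarrow> 'v::real_vector"
  assumes cox: "coxeter_system W S" and fin: "finite S" and basis: "simple_root_basis S \<alpha>"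
begin

interpretation group W using cox by (simp add: coxeter_system_def)

lemma S_carrier: "S \<subseteq> carrier W"
  using cox by (simp add: coxeter_system_def)

lemma S_involution: "s \<in> S \<Longrightarrow> s \<otimes>\<^bsub>W\<^esub> s = \<one>\<^bsub>W\<^esub>"
  using cox S_carrier pow_ord_eq_1[of s] by (auto simp: coxeter_system_def numeral_2_eq_2)

lemma S_inv: "s \<in> S \<Longrightarrow> inv\<^bsub>W\<^esub> s = s"
  using S_involution S_carrier by (meson inv_equality subsetD)

lemma cox_m_same: "s \<in> S \<Longrightarrow> cox_m W s s = 1"
  by (simp add: cox_m_def S_involution)

lemma cox_m_sym: "s \<in> S \<Longrightarrow> t \<in> S \<Longrightarrow> cox_m W s t = cox_m W t s"
  unfolding cox_m_def using S_carrier S_inv ord_inv[of "s \<otimes>\<^bsub>W\<^esub> t"]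
  by (auto simp: inv_mult_group subset_iff)

lemma cox_m_eq_1: "s \<in> S \<Longrightarrow> t \<in> S \<Longrightarrow> cox_m W s t = 1 \<Longrightarrow> s = t"
  unfolding cox_m_def using S_carrier S_inv ord_eq_1[of "s \<otimes>\<^bsub>W\<^esub> t"]
  by (metis inv_equality inv_inv m_closed subsetD)

lemma coord_simple: "s \<in> S \<Longrightarrow> t \<in> S \<Longrightarrow> coord S \<alpha> (\<alpha> s) t = (if s = t then 1 else 0)"
  using basis by (auto simp: coord_def simple_root_basis_def representation_basis inj_on_eq_iff)

lemma linear_coord: "linear (\<lambda>v. coord S \<alpha> v s)"
  using basis by (intro linearI)
    (auto simp: coord_def simple_root_basis_def representation_add representation_scale)

lemma cox_form_sym: "cox_form W S \<alpha> u v = cox_form W S \<alpha> v u"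
  unfolding cox_form_def
  by (subst sum.swap) (auto intro!: sum.cong simp: gram_def cox_m_sym)

lemma linear_cox_form: "linear (cox_form W S \<alpha> u)"
  by (intro linearI)
    (simp_all add: cox_form_def linear_add[OF linear_coord] linear_scale[OF linear_coord]
      algebra_simps sum.distrib sum_distrib_left)

lemma bilinear_cox_form: "bilinear (cox_form W S \<alpha>)"
proof -
  have "(\<lambda>u. cox_form W S \<alpha> u v) = cox_form W S \<alpha> v" for v
    by (simp add: fun_eq_iff cox_form_sym)
  then show ?thesis by (simp add: bilinear_def linear_cox_form)
qed

lemma cox_form_simple: 
  assumes "s \<in> S" "t \<in> S"
  shows "cox_form W S \<alpha> (\<alpha> s) (\<alpha> t) = gram W s t"
proof -
  have "cox_form W S \<alpha> (\<alpha> s) (\<alpha> t) = 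
      (\<Sum>s'\<in>S. \<Sum>t'\<in>S. if s' = s then (if t' = t then gram W s t else 0) else 0)"
    unfolding cox_form_def using assms by (intro sum.cong) (auto simp: coord_simple)
  also have "\<dots> = (\<Sum>s'\<in>S. if s' = s then (\<Sum>t'\<in>S. if t' = t then gram W s t else 0) else 0)"
    by (intro sum.cong) auto
  also have "\<dots> = gram W s t"
    using assms fin by simp
  finally show ?thesis .
qed

lemma root_reflection_involution:
  "s \<in> S \<Longrightarrow> root_reflection W S \<alpha> (\<alpha> s) \<circ> root_reflection W S \<alpha> (\<alpha> s) = id"
  using linear_cox_form[of "\<alpha> s"]
  by (auto simp: root_reflection_def fun_eq_iff linear_diff linear_scale cox_form_simple
      gram_def cox_m_same)

lemma root_reflection_power:
  assumes "s \<in> S" "t \<in> S"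
  shows "(root_reflection W S \<alpha> (\<alpha> s) \<circ> root_reflection W S \<alpha> (\<alpha> t)) ^^ cox_m W s t = id"
proof (cases "cox_m W s t \<le> 1")
  case True
  then consider "cox_m W s t = 0" | "cox_m W s t = 1" by linarith
  then show ?thesis
  proof cases
    case 2
    with cox_m_eq_1 assms have "s = t" by blast
    with 2 assms root_reflection_involution show ?thesis by simp
  qed simp
next
  case False
  define m where "m = cox_m W s t"
  define \<theta> where "\<theta> = pi / real m"
  have m: "m > 1" using False by (simp add: m_def)
  have "\<theta> > 0" "\<theta> < pi" using m by (simp_all add: \<theta>_def field_simps)
  then have sin: "sin \<theta> \<noteq> 0" using sin_gt_zero by force
  have m\<theta>: "real m * \<theta> = pi" using m by (simp add: \<theta>_def)
  have g: "gram W s s = 1" "gram W t t = 1" "gram W s t = - cos \<theta>" "gram W t s = - cos \<theta>"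
    using assms m cox_m_sym[of s t] by (simp_all add: gram_def cox_m_same \<theta>_def m_def)
  have "((root_reflection W S \<alpha> (\<alpha> s) \<circ> root_reflection W S \<alpha> (\<alpha> t)) ^^ m) v = v" for v
    unfolding root_reflection_def
    using dihedral_power[of "cox_form W S \<alpha>" "\<alpha> s" "\<alpha> t" \<theta> m v] assms sin m\<theta>
    by (simp add: linear_cox_form cox_form_simple g)
  then show ?thesis by (auto simp: m_def)
qed

lemma cox_eq_word_act: "cox_eq W S u v \<Longrightarrow> word_act W S \<alpha> u = word_act W S \<alpha> v"
  by (induction rule: cox_eq.induct)
    (auto simp: word_act_append word_act_power root_reflection_power)

lemma ex_word:
  assumes "w \<in> carrier W"
  shows "\<exists>u\<in>lists S. word_prod W u = w"
proof -
  have "w \<in> generate W S" using cox assms by (simp add: coxeter_system_def)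
  then show ?thesis
  proof induction
    case one
    show ?case by (intro bexI[of _ "[]"]) auto
  next
    case (incl h)
    then show ?case using S_carrier by (intro bexI[of _ "[h]"]) auto
  next
    case (inv h)
    then show ?case using S_carrier S_inv by (intro bexI[of _ "[h]"]) auto
  next
    case (eng h1 h2)
    then obtain u v where "u \<in> lists S" "word_prod W u = h1" "v \<in> lists S" "word_prod W v = h2"
      by blast
    then show ?case using S_carrier
      by (intro bexI[of _ "u @ v"]) (auto simp: word_prod_append in_lists_conv_set subset_iff)
  qed
qed

lemma geom_act_word_prod:
  assumes "u \<in> lists S"
  shows "geom_act W S \<alpha> (word_prod W u) = word_act W S \<alpha> u"
  unfolding geom_act_def
proof (rule the_equality)
  fix f assume "\<exists>v\<in>lists S. word_prod W v = word_prod W u \<and> f = word_act W S \<alpha> v"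
  then show "f = word_act W S \<alpha> u"
    using cox assms cox_eq_word_act unfolding coxeter_system_def by blast
qed (use assms in blast)

lemma geom_act_one: "geom_act W S \<alpha> \<one>\<^bsub>W\<^esub> = id"
  using geom_act_word_prod[of "[]"] by simp

lemma geom_act_simple: "s \<in> S \<Longrightarrow> geom_act W S \<alpha> s = root_reflection W S \<alpha> (\<alpha> s)"
  using geom_act_word_prod[of "[s]"] S_carrier by auto

lemma geom_act_mult:
  assumes "x \<in> carrier W" "y \<in> carrier W"
  shows "geom_act W S \<alpha> (x \<otimes>\<^bsub>W\<^esub> y) = geom_act W S \<alpha> x \<circ> geom_act W S \<alpha> y"
proof -
  obtain u v where "u \<in> lists S" "word_prod W u = x" "v \<in> lists S" "word_prod W v = y"
    using assms ex_word by blast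
  then show ?thesis
    using geom_act_word_prod[of u] geom_act_word_prod[of v] geom_act_word_prod[of "u @ v"]
      S_carrier word_prod_append[of W u v] is_group
    by (auto simp: word_act_append in_lists_conv_set subset_iff)
qed

end

end

theory Submission
  imports Defs
begin

text \<open>
  All three injectivity claims reduce to the first. The space \<open>AM(x)\<close> is a function of \<open>T(x)\<close> by
  definition, and it is also a function of \<open>P(x)\<close>: every element of \<open>P(x)\<close> acts trivially on
  \<open>V / AM(x)\<close>, so the root of any reflection in \<open>P(x)\<close> lies in \<open>AM(x)\<close>
  (\<open>abs_moved_space_par_subgroup\<close>). Monotonicity is the transitivity of the absolute order.

  To recover \<open>x\<close> from \<open>AM(x)\<close>, one would like to identify \<open>AM(x)\<close> with the moved space, the image
  of \<open>x - 1\<close>. On \<open>V\<close> itself this fails, because the form \<open>B\<close> may be degenerate. Therefore \<open>W\<close> is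
  made to act on \<open>V \<times> V\<close>, whose second factor stands for the dual of \<open>V\<close>, with the form that adds to
  \<open>B\<close> the pairing of the two factors. Reflections act there through the roots \<open>(\<beta>, 0)\<close>, and linearly
  independent roots now define linearly independent functionals. Two consequences are pure linear
  algebra. A product of reflections in independent roots moves exactly the span of these roots
  (\<open>reflect_prod_moved_space\<close>). And if a map has two factorizations into reflections in
  independent roots, with initial segments whose roots have the same span, then these initial
  segments have the same product (\<open>factor_determined_by_span\<close>).

  A Coxeter element \<open>c\<close> is a product of the reflections in the basis of simple roots, so it moves
  all of \<open>V \<times> 0\<close>. Hence the roots of any \<open>T\<close>-factorization of \<open>c\<close> span \<open>V\<close>; thus \<open>\<ell>\<^sub>T(c) = |S|\<close>, and the
  roots of a factorization of this length are independent (\<open>factorization_c\<close>). A reduced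
  factorization of \<open>x \<le>\<^sub>T c\<close> extends to one of \<open>c\<close>. It follows that \<open>AM(x)\<close> is the moved space of \<open>x\<close>
  on \<open>V \<times> V\<close>, and that it determines the action of \<open>x\<close>.

  The rest is the classical theorem of Tits that \<open>w \<alpha>\<^sub>s\<close> is a nonnegative combination of simple roots
  when \<open>w s\<close> is longer than \<open>w\<close> (\<open>act_simple_root_nonneg\<close>). It makes the positive root of a
  reflection well defined, and it makes the action faithful, so that the action of \<open>x\<close>
  determines \<open>x\<close>.
\<close>

section \<open>Products of reflections in a symmetric bilinear form\<close>

locale symmetric_form =
  fixes F :: "'e::real_vector \<Rightarrow> 'e \<Rightarrow> real"
  assumes bilinear_form: "bilinear F"
    and form_sym: "F x y = F y x"
begin

definition reflect :: "'e \<Rightarrow> 'e \<Rightarrow> 'e"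
  where "reflect b z = z - (2 * F b z) *\<^sub>R b"

definition reflect_prod :: "'e list \<Rightarrow> 'e \<Rightarrow> 'e"
  where "reflect_prod bs = foldr (\<lambda>b g. reflect b \<circ> g) bs id"

text \<open>For finite \<open>A\<close> this says that the functionals \<open>F b\<close> with \<open>b \<in> A\<close> are distinct and linearly
  independent. It is stronger than independence of \<open>A\<close> when \<open>F\<close> is degenerate.\<close>

definition dual_free :: "'e set \<Rightarrow> bool"
  where "dual_free A \<longleftrightarrow> (\<forall>d. \<exists>z. \<forall>b\<in>A. F b z = d b)"

lemma dual_free_subset: "dual_free B \<Longrightarrow> A \<subseteq> B \<Longrightarrow> dual_free A"
  unfolding dual_free_def by (erule all_forward, erule ex_forward) blast

lemma linear_form: "linear (F x)" "linear (\<lambda>y. F y x)"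
  using bilinear_form by (auto simp: bilinear_def)

lemmas form_simps =
  linear_add[OF linear_form(1)] linear_add[OF linear_form(2)]
  linear_diff[OF linear_form(1)] linear_diff[OF linear_form(2)]
  linear_scale[OF linear_form(1)] linear_scale[OF linear_form(2)]
  linear_neg[OF linear_form(1)] linear_neg[OF linear_form(2)]
  linear_0[OF linear_form(1)] linear_0[OF linear_form(2)]

lemma reflect_prod_simps [simp]:
  "reflect_prod [] z = z" "reflect_prod (b # bs) z = reflect b (reflect_prod bs z)"
  by (simp_all add: reflect_prod_def)

lemma reflect_prod_append: "reflect_prod (bs @ ds) z = reflect_prod bs (reflect_prod ds z)"
  by (induction bs) auto

lemma linear_reflect: "linear (reflect b)"
  by (intro linearI) (simp_all add: reflect_def form_simps algebra_simps)

lemma linear_reflect_prod: "linear (reflect_prod bs)"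
proof (induction bs)
  case Nil
  then show ?case by (simp add: linear_iff)
next
  case (Cons b bs)
  then have "linear (reflect b \<circ> reflect_prod bs)" by (intro linear_compose linear_reflect)
  then show ?case by (simp add: o_def)
qed

lemma reflect_prod_moves_in_span: "reflect_prod bs z - z \<in> span (set bs)"
proof (induction bs)
  case Nil
  then show ?case by (simp add: span_zero)
next
  case (Cons b bs)
  let ?y = "reflect_prod bs z"
  have "?y - z \<in> span (set (b # bs))"
    using Cons span_mono[of "set bs" "set (b # bs)"] by auto
  moreover have "(2 * F b ?y) *\<^sub>R b \<in> span (set (b # bs))"
    by (intro span_scale span_base) simp
  ultimately have "(?y - z) - (2 * F b ?y) *\<^sub>R b \<in> span (set (b # bs))"
    by (rule span_diff)
  then show ?case by (simp add: reflect_def algebra_simps)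
qed

lemma reflect_prod_fixes_orthogonal:
  "(\<And>b. b \<in> set bs \<Longrightarrow> F b z = 0) \<Longrightarrow> reflect_prod bs z = z"
  by (induction bs) (auto simp: reflect_def)

lemma orthogonal_span:
  assumes "\<And>b. b \<in> A \<Longrightarrow> F b z = 0" "x \<in> span A"
  shows "F x z = 0"
  using assms(2)
  by (induction rule: span_induct_alt) (auto simp: assms(1) form_simps)

text \<open>The coefficient with which the reflection in \<open>b\<close> moves its argument \<open>y\<close> is \<open>- 2 F b y\<close>. When the
  moves of the later factors are already prescribed, \<open>y\<close> is \<open>z\<close> plus a known vector, so prescribing
  the coefficient \<open>q b\<close> amounts to prescribing \<open>F b z\<close>: the system is triangular.\<close>

lemma reflect_prod_prescribed_move:
  assumes "distinct bs"
  shows "\<exists>d. \<forall>z. (\<forall>b\<in>set bs. F b z = d b) \<longrightarrow>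
    reflect_prod bs z = z + (\<Sum>b\<in>set bs. q b *\<^sub>R b)"
  using assms
proof (induction bs)
  case Nil
  then show ?case by simp
next
  case (Cons b bs)
  then obtain d where d: "\<And>z. (\<forall>b\<in>set bs. F b z = d b) \<Longrightarrow>
      reflect_prod bs z = z + (\<Sum>b\<in>set bs. q b *\<^sub>R b)"
    by auto
  define u where "u = (\<Sum>b\<in>set bs. q b *\<^sub>R b)"
  \<comment> \<open>the solution of \<open>- 2 F b (z + u) = q b\<close> for \<open>F b z\<close>\<close>
  define d' where "d' = d(b := - q b / 2 - F b u)"
  have "reflect_prod (b # bs) z = z + (\<Sum>b\<in>set (b # bs). q b *\<^sub>R b)"
    if z: "\<forall>x\<in>set (b # bs). F x z = d' x" for z
  proof -
    have "reflect_prod bs z = z + u"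
      unfolding u_def using z Cons.prems by (intro d) (auto simp: d'_def)
    moreover have "F b z = - q b / 2 - F b u" using z by (simp add: d'_def)
    ultimately have "reflect_prod (b # bs) z = z + u + q b *\<^sub>R b"
      by (simp add: reflect_def form_simps)
    then show ?thesis using Cons.prems by (simp add: u_def)
  qed
  then show ?case by blast
qed

lemma reflect_prod_moved_space:
  assumes "distinct bs" "dual_free (set bs)"
  shows "range (\<lambda>z. reflect_prod bs z - z) = span (set bs)"
proof
  show "span (set bs) \<subseteq> range (\<lambda>z. reflect_prod bs z - z)"
  proof
    fix u assume "u \<in> span (set bs)"
    then obtain q where q: "u = (\<Sum>b\<in>set bs. q b *\<^sub>R b)"
      by (auto simp: span_finite)
    obtain d where d: "\<forall>z. (\<forall>b\<in>set bs. F b z = d b) \<longrightarrow> reflect_prod bs z = z + u"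
      using reflect_prod_prescribed_move[OF assms(1), of q] q by auto
    from assms(2) obtain z where "\<forall>b\<in>set bs. F b z = d b" by (auto simp: dual_free_def)
    with d have "u = reflect_prod bs z - z" by simp
    then show "u \<in> range (\<lambda>z. reflect_prod bs z - z)" by blast
  qed
qed (auto simp: reflect_prod_moves_in_span)

text \<open>Testing against a vector that is dual to one element of \<open>A\<close> and orthogonal to all the other
  elements of \<open>A \<union> A'\<close> isolates one coefficient of \<open>x\<close> with respect to \<open>A\<close>; it vanishes because \<open>x\<close> also
  lies in the span of \<open>A'\<close>.\<close>

lemma dual_free_disjoint_spans:
  assumes free: "dual_free (A \<union> A')" and fin: "finite A" and disj: "A \<inter> A' = {}"
    and x: "x \<in> span A" "x \<in> span A'"
  shows "x = 0"
proof -
  obtain q where q: "x = (\<Sum>b\<in>A. q b *\<^sub>R b)"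
    using x fin by (auto simp: span_finite)
  have "q a = 0" if a: "a \<in> A" for a
  proof -
    obtain z where z: "\<And>b. b \<in> A \<union> A' \<Longrightarrow> F b z = (if b = a then 1 else 0)"
      using free[unfolded dual_free_def, rule_format, of "\<lambda>b. if b = a then 1 else 0"] by auto
    have "F x z = (\<Sum>b\<in>A. q b * F b z)"
      unfolding q by (simp add: linear_sum[OF linear_form(2)] form_simps)
    also have "\<dots> = (\<Sum>b\<in>A. if b = a then q b else 0)"
      using z by (intro sum.cong) auto
    also have "\<dots> = q a" using fin a by simp
    finally show ?thesis
      using orthogonal_span[OF _ x(2), of z] z a disj by (metis UnI2 disjoint_iff)
  qed
  then show ?thesis by (simp add: q)
qed

text \<open>Write \<open>c = x y\<close> and \<open>c = x' y'\<close> for the two factorizations, and \<open>U\<close> for the common span. Any \<open>a\<close>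
  can be changed by a vector orthogonal to \<open>U\<close>, hence fixed by \<open>x\<close>, into some \<open>b\<close> fixed by \<open>y\<close>, and
  then \<open>c b - b = x a - a\<close>. Likewise \<open>c b' - b' = x' a - a\<close>. The difference \<open>d = b - b'\<close> is orthogonal
  to \<open>U\<close>, and \<open>c d - d\<close> lies in \<open>U\<close>. Since \<open>c d - d = x (y d - d)\<close> and \<open>x\<close> changes vectors by elements
  of \<open>U\<close> only, \<open>y d - d\<close> lies both in \<open>U\<close> and in the moved space of \<open>y\<close>, so it is zero. Thus
  \<open>c d = d\<close>, which says \<open>x a = x' a\<close>.\<close>

theorem factor_determined_by_span:
  assumes bs: "distinct (bs @ bs')" "dual_free (set (bs @ bs'))"
    and ds: "distinct (ds @ ds')" "dual_free (set (ds @ ds'))"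
    and eq: "reflect_prod (bs @ bs') = reflect_prod (ds @ ds')"
    and span: "span (set bs) = span (set ds)"
  shows "reflect_prod bs = reflect_prod ds"
proof
  fix a
  have lift: "\<exists>b. (\<forall>x\<in>set as. F x b = F x a) \<and> (\<forall>x\<in>set as'. F x b = 0)"
    if dist: "distinct (as @ as')" and free: "dual_free (set (as @ as'))" for as as'
  proof -
    obtain b where "\<And>x. x \<in> set (as @ as') \<Longrightarrow> F x b = (if x \<in> set as then F x a else 0)"
      using free[unfolded dual_free_def, rule_format,
          of "\<lambda>x. if x \<in> set as then F x a else 0"] by auto
    then show ?thesis using dist by (intro exI[of _ b]) auto
  qed
  obtain b where b: "\<And>x. x \<in> set bs \<Longrightarrow> F x b = F x a" "\<And>x. x \<in> set bs' \<Longrightarrow> F x b = 0"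
    using lift[OF bs] by auto
  obtain b' where b': "\<And>x. x \<in> set ds \<Longrightarrow> F x b' = F x a" "\<And>x. x \<in> set ds' \<Longrightarrow> F x b' = 0"
    using lift[OF ds] by auto
  have move: "reflect_prod (as @ as') e - e = reflect_prod as a - a"
    if "\<And>x. x \<in> set as \<Longrightarrow> F x e = F x a" "\<And>x. x \<in> set as' \<Longrightarrow> F x e = 0" for as as' e
  proof -
    have "reflect_prod as (e - a) = e - a"
      using that by (intro reflect_prod_fixes_orthogonal) (simp add: form_simps)
    then show ?thesis
      using that reflect_prod_fixes_orthogonal[of as' e]
      by (simp add: reflect_prod_append linear_diff[OF linear_reflect_prod] algebra_simps)
  qed
  define d where "d = b - b'"
  define c where "c = reflect_prod (bs @ bs')"
  have cd: "c d - d = (reflect_prod bs a - a) - (reflect_prod ds a - a)"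
  proof -
    have "c d - d = (c b - b) - (c b' - b')"
      by (simp add: c_def d_def linear_diff[OF linear_reflect_prod])
    also have "c b - b = reflect_prod bs a - a"
      unfolding c_def by (rule move[OF b])
    also have "c b' - b' = reflect_prod ds a - a"
      unfolding c_def eq by (rule move[OF b'])
    finally show ?thesis .
  qed
  have U: "c d - d \<in> span (set bs)"
    unfolding cd
    by (rule span_diff[OF reflect_prod_moves_in_span]) (simp add: span reflect_prod_moves_in_span)
  have "F x d = 0" if "x \<in> set bs" for x
  proof -
    have "x \<in> span (set ds)" using that span_base span by blast
    then have "F x (b' - a) = 0"
      by (rule orthogonal_span[rotated]) (simp add: b'(1) linear_diff[OF linear_form(1)])
    then show ?thesis using b(1)[OF that] by (simp add: d_def linear_diff[OF linear_form(1)])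
  qed
  then have xd: "reflect_prod bs d = d" by (rule reflect_prod_fixes_orthogonal)
  define m where "m = reflect_prod bs' d - d"
  have xm: "reflect_prod bs m = c d - d"
    by (simp add: m_def c_def reflect_prod_append linear_diff[OF linear_reflect_prod] xd)
  have "m \<in> span (set bs')" by (simp add: m_def reflect_prod_moves_in_span)
  moreover have "m \<in> span (set bs)"
    using span_diff[OF U reflect_prod_moves_in_span[of bs m]] xm by simp
  ultimately have "m = 0"
    using bs dual_free_disjoint_spans[of "set bs" "set bs'" m] by auto
  with xm have "c d - d = 0" by (simp add: linear_0[OF linear_reflect_prod])
  with cd show "reflect_prod bs a = reflect_prod ds a" by simp
qed

end


section \<open>Lengths and alternating words\<close>

text \<open>The recursion extends the word on the left, where the letter depends on the parity; the last
  letter is always \<open>t\<close>.\<close>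

fun alt_word :: "nat \<Rightarrow> 'a \<Rightarrow> 'a \<Rightarrow> 'a list"
  where
    "alt_word 0 s t = []"
  | "alt_word (Suc k) s t = (if even k then t else s) # alt_word k s t"

lemma length_alt_word [simp]: "length (alt_word k s t) = k"
  by (induction k) auto

lemma alt_word_snoc: "alt_word (Suc k) s t = alt_word k t s @ [t]"
  by (induction k) auto

lemma set_alt_word: "set (alt_word k s t) \<subseteq> {s, t}"
  by (induction k) auto

text \<open>Chebyshev polynomials of the second kind, with the index shifted by one. Evaluated at
  \<open>- B(\<alpha>\<^sub>s, \<alpha>\<^sub>t)\<close> they are the coordinates of the roots of the dihedral group generated by \<open>s\<close> and \<open>t\<close>.\<close>

fun chebU :: "real \<Rightarrow> nat \<Rightarrow> real"
  where
    "chebU c 0 = 0"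
  | "chebU c (Suc 0) = 1"
  | "chebU c (Suc (Suc k)) = 2 * c * chebU c (Suc k) - chebU c k"

lemma chebU_cos: "chebU (cos \<theta>) k * sin \<theta> = sin (k * \<theta>)"
proof (induction "cos \<theta>" k rule: chebU.induct)
  case (3 k)
  have *: "real (Suc (Suc k)) * \<theta> = real (Suc k) * \<theta> + \<theta>" "real k * \<theta> = real (Suc k) * \<theta> - \<theta>"
    by (simp_all add: algebra_simps)
  have "chebU (cos \<theta>) (Suc (Suc k)) * sin \<theta> =
      2 * cos \<theta> * (chebU (cos \<theta>) (Suc k) * sin \<theta>) - chebU (cos \<theta>) k * sin \<theta>"
    by (simp add: algebra_simps)
  also have "\<dots> = 2 * cos \<theta> * sin (Suc k * \<theta>) - sin (k * \<theta>)"
    by (simp only: 3)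
  also have "\<dots> = sin (Suc (Suc k) * \<theta>)"
    unfolding * sin_add sin_diff by (simp add: algebra_simps)
  finally show ?case .
qed simp_all

lemma chebU_1: "chebU 1 k = k"
  by (induction "1::real" k rule: chebU.induct) auto

locale geometric_coxeter =
  fixes W :: "('a, 'b) monoid_scheme" (structure) and S :: "'a set"
    and \<alpha> :: "'a \<Rightarrow> 'v::real_vector"
  assumes cox: "coxeter_system W S" and fin: "finite S" and basis: "simple_root_basis S \<alpha>"
begin

sublocale group W using cox by (simp add: coxeter_system_def)

abbreviation wp :: "'a list \<Rightarrow> 'a" where "wp \<equiv> word_prod W"
abbreviation act :: "'a \<Rightarrow> 'v \<Rightarrow> 'v" where "act \<equiv> geom_act W S \<alpha>"
abbreviation crd :: "'v \<Rightarrow> 'a \<Rightarrow> real" where "crd \<equiv> coord S \<alpha>"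
abbreviation B :: "'v \<Rightarrow> 'v \<Rightarrow> real" where "B \<equiv> cox_form W S \<alpha>"

lemmas S_car = S_carrier[OF cox fin basis]
lemmas S_invol = S_involution[OF cox fin basis]
lemmas act_wp = geom_act_word_prod[OF cox fin basis]
lemmas act_one = geom_act_one[OF cox fin basis]
lemmas act_gen = geom_act_simple[OF cox fin basis]
lemmas act_mult = geom_act_mult[OF cox fin basis]
lemmas lin_crd = linear_coord[OF cox fin basis]
lemmas lin_B = linear_cox_form[OF cox fin basis]
lemmas B_sym = cox_form_sym[OF cox fin basis]
lemmas B_gen = cox_form_simple[OF cox fin basis]
lemmas crd_gen = coord_simple[OF cox fin basis]

lemma gen_closed [simp]: "s \<in> S \<Longrightarrow> s \<in> carrier W"
  using S_car by blast

lemma wp_closed [simp]: "u \<in> lists S \<Longrightarrow> wp u \<in> carrier W"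
  using S_car by (intro word_prod_closed is_group) auto

lemma wp_append: "u \<in> lists S \<Longrightarrow> v \<in> lists S \<Longrightarrow> wp (u @ v) = wp u \<otimes> wp v"
  using S_car by (intro word_prod_append is_group) auto

lemma mult_gen_gen [simp]:
  "w \<in> carrier W \<Longrightarrow> s \<in> S \<Longrightarrow> w \<otimes> s \<otimes> s = w"
  "w \<in> carrier W \<Longrightarrow> s \<in> S \<Longrightarrow> s \<otimes> (s \<otimes> w) = w"
  by (simp add: m_assoc S_invol, simp add: S_invol flip: m_assoc)

lemma alt_word_lists [simp]: "s \<in> S \<Longrightarrow> t \<in> S \<Longrightarrow> alt_word k s t \<in> lists S"
  using set_alt_word[of k s t] by auto

definition len :: "'a \<Rightarrow> nat"
  where "len w = (LEAST k. \<exists>u\<in>lists S. length u = k \<and> wp u = w)"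

lemma len_le: "u \<in> lists S \<Longrightarrow> len (wp u) \<le> length u"
  unfolding len_def by (rule Least_le) blast

lemma ex_reduced_word:
  assumes "w \<in> carrier W"
  obtains u where "u \<in> lists S" "length u = len w" "wp u = w"
proof -
  have "\<exists>k. \<exists>u\<in>lists S. length u = k \<and> wp u = w" using ex_word[OF cox fin basis assms] by blast
  then have "\<exists>u\<in>lists S. length u = len w \<and> wp u = w" unfolding len_def by (rule LeastI_ex)
  then show thesis using that by blast
qed

lemma len_mult:
  assumes "x \<in> carrier W" "y \<in> carrier W"
  shows "len (x \<otimes> y) \<le> len x + len y"
proof -
  obtain u v where "u \<in> lists S" "length u = len x" "wp u = x"
    "v \<in> lists S" "length v = len y" "wp v = y"
    using assms by (metis ex_reduced_word)
  then show ?thesis using len_le[of "u @ v"] by (simp add: wp_append)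
qed

text \<open>The relators \<open>(s t)\<^sup>m\<close> have even length; so multiplication by a generator always changes the
  length of an element.\<close>

lemma cox_eq_length_parity: "cox_eq W S u v \<Longrightarrow> even (length u) \<longleftrightarrow> even (length v)"
proof (induction rule: cox_eq.induct)
  case (rel u v s t)
  have "length (concat (replicate n [s, t])) = 2 * n" for n by (induction n) auto
  then show ?case by simp
qed auto

lemma even_len:
  assumes "u \<in> lists S"
  shows "even (len (wp u)) \<longleftrightarrow> even (length u)"
proof -
  obtain v where v: "v \<in> lists S" "length v = len (wp u)" "wp v = wp u"
    using ex_reduced_word[of "wp u"] assms by auto
  then have "cox_eq W S v u" using cox assms by (auto simp: coxeter_system_def)
  with v(2) cox_eq_length_parity show ?thesis by metis
qed

lemma len_gen_le: "s \<in> S \<Longrightarrow> len s \<le> 1"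
  using len_le[of "[s]"] by simp

lemma len_mult_gen:
  assumes "w \<in> carrier W" "s \<in> S"
  shows "len (w \<otimes> s) = Suc (len w) \<or> len w = Suc (len (w \<otimes> s))"
proof -
  obtain u where u: "u \<in> lists S" "length u = len w" "wp u = w"
    using assms(1) by (rule ex_reduced_word)
  have "wp (u @ [s]) = w \<otimes> s" using u assms wp_append[of u "[s]"] by simp
  then have "even (len (w \<otimes> s)) \<longleftrightarrow> odd (len w)"
    using even_len[of "u @ [s]"] u assms by simp
  moreover have "len (w \<otimes> s) \<le> Suc (len w)"
    using len_mult[of w s] len_gen_le[of s] assms by simp
  moreover have "len w \<le> Suc (len (w \<otimes> s))"
    using len_mult[of "w \<otimes> s" s] len_gen_le[of s] assms by simp
  ultimately show ?thesis by (cases "len (w \<otimes> s) = len w") (auto simp: le_Suc_eq)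
qed

lemma conj_pow:
  assumes "s \<in> carrier W" "t \<in> carrier W"
  shows "t \<otimes> ((s \<otimes> t) [^] (k::nat) \<otimes> s) = (t \<otimes> s) [^] Suc k"
proof (induction k)
  case (Suc k)
  have "t \<otimes> ((s \<otimes> t) [^] Suc k \<otimes> s) = t \<otimes> ((s \<otimes> t) [^] k \<otimes> s) \<otimes> (t \<otimes> s)"
    using assms by (simp add: m_assoc)
  then show ?case using Suc by simp
qed (use assms in simp)

text \<open>The product of the alternating word ending in \<open>t\<close> and the inverse of the one ending in \<open>s\<close> is
  alternating of length \<open>2 k\<close>, so it is a power of \<open>s t\<close> or \<open>t s\<close>. For \<open>k = m\<^sub>s\<^sub>t\<close> the power is trivial,
  which gives the braid relation.\<close>

lemma alt_word_swap:
  assumes st: "s \<in> S" "t \<in> S"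
  shows "wp (alt_word k s t) = (if even k then s \<otimes> t else t \<otimes> s) [^] k \<otimes> wp (alt_word k t s)"
proof (induction k)
  case (Suc k)
  define x where "x = (if even k then t else s)"
  define y where "y = (if even k then s else t)"
  have xy: "x \<in> S" "y \<in> S" using st by (auto simp: x_def y_def)
  have "wp (alt_word (Suc k) s t) = x \<otimes> ((y \<otimes> x) [^] k \<otimes> wp (alt_word k t s))"
    using Suc by (auto simp: x_def y_def)
  also have "\<dots> = x \<otimes> ((y \<otimes> x) [^] k \<otimes> (y \<otimes> (y \<otimes> wp (alt_word k t s))))"
    using st xy by simp
  also have "\<dots> = (x \<otimes> ((y \<otimes> x) [^] k \<otimes> y)) \<otimes> (y \<otimes> wp (alt_word k t s))"
    using st xy by (simp add: m_assoc)
  also have "\<dots> = (x \<otimes> y) [^] Suc k \<otimes> (y \<otimes> wp (alt_word k t s))"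
    using xy by (simp only: conj_pow gen_closed)
  finally show ?case by (auto simp: x_def y_def)
qed simp

lemma braid:
  assumes st: "s \<in> S" "t \<in> S"
  shows "wp (alt_word (cox_m W s t) s t) = wp (alt_word (cox_m W s t) t s)"
proof -
  have "(s \<otimes> t) [^] cox_m W s t = \<one>" "(t \<otimes> s) [^] cox_m W t s = \<one>"
    using st by (simp_all add: cox_m_def pow_ord_eq_1)
  then show ?thesis using alt_word_swap[OF st, of "cox_m W s t"] st cox_m_sym[OF cox fin basis st] by auto
qed



section \<open>Every root is positive or negative\<close>

definition nonneg :: "'v \<Rightarrow> bool"
  where "nonneg v \<longleftrightarrow> (\<forall>s\<in>S. crd v s \<ge> 0)"

lemma nonneg_gen: "s \<in> S \<Longrightarrow> nonneg (\<alpha> s)"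
  by (simp add: nonneg_def crd_gen)

lemma nonneg_combination:
  "nonneg u \<Longrightarrow> nonneg v \<Longrightarrow> p \<ge> 0 \<Longrightarrow> q \<ge> 0 \<Longrightarrow> nonneg (p *\<^sub>R u + q *\<^sub>R v)"
  by (simp add: nonneg_def linear_add[OF lin_crd] linear_scale[OF lin_crd])

lemma linear_root_reflection: "linear (root_reflection W S \<alpha> \<beta>)"
  by (intro linearI)
    (simp_all add: root_reflection_def linear_add[OF lin_B] linear_scale[OF lin_B] algebra_simps)

lemma linear_act:
  assumes "w \<in> carrier W"
  shows "linear (act w)"
proof -
  obtain u where u: "u \<in> lists S" "wp u = w" using assms by (metis ex_reduced_word)
  have "linear (word_act W S \<alpha> u)"
  proof (induction u)
    case Nil
    show ?case by (simp add: linear_iff)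
  next
    case (Cons s u)
    show ?case
      using linear_compose[OF Cons linear_root_reflection] by (simp add: o_def)
  qed
  with u act_wp show ?thesis by metis
qed

lemma act_gen_root:
  assumes "s \<in> S" "t \<in> S"
  shows "act t (\<alpha> s) = \<alpha> s - (2 * gram W t s) *\<^sub>R \<alpha> t"
  using assms by (simp add: act_gen root_reflection_def B_gen)

lemma gram_self: "s \<in> S \<Longrightarrow> gram W s s = 1"
  by (simp add: gram_def cox_m_same[OF cox fin basis])

lemma act_gen_self: "s \<in> S \<Longrightarrow> act s (\<alpha> s) = - \<alpha> s"
  by (simp add: act_gen_root gram_self scaleR_2)

lemma gram_sym: "s \<in> S \<Longrightarrow> t \<in> S \<Longrightarrow> gram W s t = gram W t s"
  by (metis B_gen B_sym)

lemma act_alt_word: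
  assumes st: "s \<in> S" "t \<in> S"
  defines "U \<equiv> chebU (- gram W s t)"
  shows "act (wp (alt_word k s t)) (\<alpha> s) =
    (if even k then U (Suc k) *\<^sub>R \<alpha> s + U k *\<^sub>R \<alpha> t else U k *\<^sub>R \<alpha> s + U (Suc k) *\<^sub>R \<alpha> t)"
proof (induction k)
  case 0
  show ?case by (simp add: act_one U_def)
next
  case (Suc k)
  define x where "x = (if even k then t else s)"
  have x: "x \<in> S" using st by (simp add: x_def)
  have "act (wp (alt_word (Suc k) s t)) (\<alpha> s) = act x (act (wp (alt_word k s t)) (\<alpha> s))"
    using x st by (simp add: act_mult x_def)
  moreover have "U (Suc (Suc k)) = - 2 * gram W s t * U (Suc k) - U k" by (simp add: U_def)
  ultimately show ?case
    using x st Suc gram_sym[OF st] linear_act[of x]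
    by (auto simp: x_def linear_add linear_scale act_gen_root gram_self algebra_simps
        simp flip: scaleR_add_left scaleR_diff_left split: if_splits)
qed

text \<open>With \<open>\<theta> = \<pi> / m\<close> the value is \<open>sin (k \<theta>) / sin \<theta>\<close>, nonnegative as long as \<open>k \<theta> \<le> \<pi>\<close>. For
  \<open>m = \<infinity>\<close> it is \<open>k\<close>.\<close>

lemma chebU_gram_nonneg:
  assumes st: "s \<in> S" "t \<in> S" "s \<noteq> t" and k: "cox_m W s t = 0 \<or> k \<le> cox_m W s t"
  shows "chebU (- gram W s t) k \<ge> 0"
proof (cases "cox_m W s t = 0")
  case True
  then show ?thesis by (simp add: gram_def chebU_1)
next
  case False
  define m where "m = cox_m W s t"
  define \<theta> where "\<theta> = pi / real m"
  have "m \<noteq> 1" using cox_m_eq_1[OF cox fin basis] st by (auto simp: m_def)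
  with False have m: "m > 1" by (simp add: m_def)
  have "\<theta> > 0" "\<theta> < pi" using m by (simp_all add: \<theta>_def field_simps)
  then have s: "sin \<theta> > 0" by (rule sin_gt_zero)
  have "k * \<theta> \<le> m * \<theta>" using k False \<open>\<theta> > 0\<close> by (simp add: m_def)
  also have "m * \<theta> = pi" using m by (simp add: \<theta>_def)
  finally have "sin (k * \<theta>) \<ge> 0" using \<open>\<theta> > 0\<close> by (intro sin_ge_zero) auto
  then have "chebU (cos \<theta>) k * sin \<theta> \<ge> 0" by (simp add: chebU_cos)
  then have "chebU (cos \<theta>) k \<ge> 0" using s by (simp add: zero_le_mult_iff)
  then show ?thesis using False by (simp add: gram_def \<theta>_def m_def)
qed

text \<open>Induction on the length of \<open>w\<close>. Let \<open>t\<close> be the last letter of a reduced word of \<open>w\<close>; then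
  \<open>t \<noteq> s\<close>. Split off from the right end of \<open>w\<close> the longest possible alternating word in \<open>s\<close> and \<open>t\<close>
  that ends in \<open>t\<close>, so that \<open>w = v a\<close> with lengths adding up. Its length \<open>k\<close> is less than \<open>m\<^sub>s\<^sub>t\<close>, since
  otherwise the braid relation would produce a reduced word of \<open>w\<close> ending in \<open>s\<close>. By maximality
  both \<open>v s\<close> and \<open>v t\<close> are longer than \<open>v\<close>, so \<open>v\<close> maps \<open>\<alpha>\<^sub>s\<close> and \<open>\<alpha>\<^sub>t\<close> to nonnegative vectors by
  induction; and \<open>a \<alpha>\<^sub>s\<close> is a nonnegative combination of \<open>\<alpha>\<^sub>s\<close> and \<open>\<alpha>\<^sub>t\<close> because \<open>k < m\<^sub>s\<^sub>t\<close>.\<close>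

theorem act_simple_root_nonneg:
  assumes "w \<in> carrier W" "s \<in> S" "len w < len (w \<otimes> s)"
  shows "nonneg (act w (\<alpha> s))"
  using assms
proof (induction "len w" arbitrary: w s rule: less_induct)
  case less
  note w [simp] = less.prems(1) and s [simp] = less.prems(2)
  obtain u where u: "u \<in> lists S" "length u = len w" "wp u = w"
    using w by (rule ex_reduced_word)
  show ?case
  proof (cases u rule: rev_cases)
    case Nil
    then show ?thesis using u nonneg_gen by (auto simp: act_one)
  next
    case (snoc u' t)
    have t [simp]: "t \<in> S" and u': "u' \<in> lists S" using u snoc by auto
    have wu': "w = wp u' \<otimes> t" using u snoc u' by (auto simp: wp_append)
    have wt: "len (w \<otimes> t) < len w"
      using len_le[OF u'] wu' u' u(2) snoc by simp
    have "s \<noteq> t" using wt less.prems(3) by auto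
    define P where "P = (\<lambda>k. \<exists>v\<in>carrier W. w = v \<otimes> wp (alt_word k s t) \<and> len v + k = len w)"
    have P1: "P (Suc 0)"
      unfolding P_def using len_mult_gen[OF w t] wt by (intro bexI[of _ "w \<otimes> t"]) auto
    have P_down: "P k" if "P (Suc k)" for k
    proof -
      define x where "x = (if even k then t else s)"
      have [simp]: "x \<in> S" by (simp add: x_def)
      from that obtain v where v: "v \<in> carrier W" "w = v \<otimes> (x \<otimes> wp (alt_word k s t))"
        "len v + Suc k = len w"
        by (auto simp: P_def x_def)
      have *: "w = v \<otimes> x \<otimes> wp (alt_word k s t)" using v by (simp add: m_assoc)
      have "len w \<le> len (v \<otimes> x) + k"
        using len_mult[of "v \<otimes> x" "wp (alt_word k s t)"] len_le[of "alt_word k s t"] v * by auto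
      then have "len (v \<otimes> x) + k = len w" using len_mult_gen[of v x] v by auto
      with * v show ?thesis unfolding P_def by (intro bexI[of _ "v \<otimes> x"]) auto
    qed
    have P_le: "P j" if "j \<le> k" "P k" for j k
      using that by (induction rule: inc_induct) (auto intro: P_down)
    have small: "cox_m W s t = 0 \<or> k < cox_m W s t" if "P k" for k
    proof (rule ccontr)
      assume neg: "\<not> ?thesis"
      define m where "m = cox_m W s t"
      obtain m' where m': "m = Suc m'" using neg by (auto simp: m_def gr0_conv_Suc)
      have "P m" using P_le[of m k] that neg by (simp add: m_def)
      then obtain v where v: "v \<in> carrier W" "w = v \<otimes> wp (alt_word m s t)" "len v + m = len w"
        by (auto simp: P_def)
      have "wp (alt_word m s t) = wp (alt_word m' s t @ [s])"
        using braid[OF s t] alt_word_snoc[of m' t s] by (metis m_def m')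
      then have "w \<otimes> s = v \<otimes> wp (alt_word m' s t)"
        using v by (simp add: wp_append m_assoc S_invol)
      then have "len (w \<otimes> s) \<le> len v + m'"
        using len_mult[of v "wp (alt_word m' s t)"] len_le[of "alt_word m' s t"] v by auto
      then show False using v m' less.prems(3) by simp
    qed
    have "\<not> P (Suc (len w))" by (auto simp: P_def)
    then obtain k where k: "\<not> P (Suc k)" "\<And>j. j < k \<Longrightarrow> P (Suc j)"
      using exists_least_iff[of "\<lambda>k. \<not> P (Suc k)"] by auto
    then obtain j where j: "k = Suc j" "P k"
      using P1 by (cases k) auto
    \<comment> \<open>\<open>y\<close> is the first letter of the alternating word, and \<open>x\<close> is the letter that would
      extend it to the left\<close>
    define x where "x = (if even k then t else s)"
    define y where "y = (if even j then t else s)"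
    have [simp]: "x \<in> S" "y \<in> S" and xy: "{x, y} = {s, t}" by (auto simp: x_def y_def j)
    from j obtain v where v: "v \<in> carrier W" "w = v \<otimes> wp (alt_word k s t)" "len v + k = len w"
      by (auto simp: P_def)
    have "len v < len (v \<otimes> x)"
    proof (rule ccontr)
      assume "\<not> ?thesis"
      then have l: "len v = Suc (len (v \<otimes> x))" using len_mult_gen[of v x] v by auto
      have "w = v \<otimes> x \<otimes> (x \<otimes> wp (alt_word k s t))" using v by (simp add: m_assoc)
      then have "P (Suc k)"
        unfolding P_def using v l by (intro bexI[of _ "v \<otimes> x"]) (auto simp: x_def)
      with k show False by simp
    qed
    moreover have "len v < len (v \<otimes> y)"
    proof -
      have "w = v \<otimes> y \<otimes> wp (alt_word j s t)" using v by (simp add: m_assoc j y_def)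
      then have "len w \<le> len (v \<otimes> y) + j"
        using len_mult[of "v \<otimes> y" "wp (alt_word j s t)"] len_le[of "alt_word j s t"] v by auto
      then show ?thesis using v j by simp
    qed
    moreover have "len v < len w" using v j by simp
    ultimately have "nonneg (act v (\<alpha> x))" "nonneg (act v (\<alpha> y))"
      using less.hyps v by auto
    then have st: "nonneg (act v (\<alpha> s))" "nonneg (act v (\<alpha> t))"
      using xy by (metis doubleton_eq_iff)+
    have U: "chebU (- gram W s t) k \<ge> 0" "chebU (- gram W s t) (Suc k) \<ge> 0"
      using small[OF \<open>P k\<close>] \<open>s \<noteq> t\<close> by (auto intro!: chebU_gram_nonneg)
    have "act w (\<alpha> s) = act v (act (wp (alt_word k s t)) (\<alpha> s))"
      using v by (simp add: act_mult)
    then show ?thesis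
      using st U linear_act[OF v(1)]
      by (simp add: act_alt_word linear_add linear_scale nonneg_combination)
  qed
qed

corollary root_sign:
  assumes "w \<in> carrier W" "s \<in> S"
  shows "nonneg (act w (\<alpha> s)) \<or> nonneg (- act w (\<alpha> s))"
proof (cases "len w < len (w \<otimes> s)")
  case False
  then have "len (w \<otimes> s) < len (w \<otimes> s \<otimes> s)" using len_mult_gen[OF assms] assms by auto
  then have "nonneg (act (w \<otimes> s) (\<alpha> s))" using assms by (intro act_simple_root_nonneg) auto
  moreover have "act (w \<otimes> s) (\<alpha> s) = - act w (\<alpha> s)"
    using assms by (simp add: act_mult act_gen_self linear_neg[OF linear_act])
  ultimately show ?thesis by simp
qed (use assms act_simple_root_nonneg in auto)

text \<open>Let \<open>s\<close> be the last letter of a nonempty reduced word of \<open>w\<close>. Then \<open>w s\<close> is shorter than \<open>w\<close>, so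
  \<open>w s\<close> maps \<open>\<alpha>\<^sub>s\<close> to a nonnegative vector, and \<open>w\<close> maps \<open>\<alpha>\<^sub>s\<close> to its negative.\<close>

theorem act_faithful:
  assumes "w \<in> carrier W" "act w = id"
  shows "w = \<one>"
proof -
  obtain u where u: "u \<in> lists S" "length u = len w" "wp u = w"
    using assms(1) by (rule ex_reduced_word)
  show ?thesis
  proof (cases u rule: rev_cases)
    case (snoc u' s)
    have s: "s \<in> S" and u': "u' \<in> lists S" using u snoc by auto
    have w: "w = wp u' \<otimes> s" using u snoc u' by (auto simp: wp_append)
    have "len (wp u') < len (wp u' \<otimes> s)"
      using len_le[OF u'] w u(2) snoc by simp
    then have "nonneg (act (wp u') (\<alpha> s))" using s u' by (intro act_simple_root_nonneg) auto
    moreover have "act (wp u') (\<alpha> s) = - \<alpha> s"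
    proof -
      have "wp u' = w \<otimes> s" using w s u' by simp
      then show ?thesis using assms s by (simp add: act_mult act_gen_self)
    qed
    ultimately have "crd (- \<alpha> s) s \<ge> 0" using s by (simp add: nonneg_def)
    then show ?thesis using s by (simp add: linear_neg[OF lin_crd] crd_gen)
  qed (use u in simp)
qed


section \<open>A nondegenerate extension of the geometric representation\<close>

text \<open>The coordinate pairing identifies the second factor of \<open>V \<times> V\<close> with the dual of \<open>V\<close>: every linear
  functional on \<open>V\<close> is \<open>pairing f\<close> for some \<open>f\<close>.\<close>

definition pairing :: "'v \<Rightarrow> 'v \<Rightarrow> real"
  where "pairing f v = (\<Sum>s\<in>S. crd f s * crd v s)"

definition ext_form :: "'v \<times> 'v \<Rightarrow> 'v \<times> 'v \<Rightarrow> real"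
  where "ext_form x y = B (fst x) (fst y) + pairing (snd x) (fst y) + pairing (snd y) (fst x)"

abbreviation lift :: "'v \<Rightarrow> 'v \<times> 'v" where "lift v \<equiv> (v, 0)"

lemma linear_pairing: "linear (pairing f)" "linear (\<lambda>f. pairing f v)"
  by (intro linearI; simp add: pairing_def linear_add[OF lin_crd] linear_scale[OF lin_crd]
      algebra_simps sum.distrib sum_distrib_left)+

lemma linear_B2: "linear (\<lambda>u. B u v)"
proof -
  have "(\<lambda>u. B u v) = B v" using B_sym by blast
  then show ?thesis by (simp add: lin_B)
qed

sublocale ext: symmetric_form ext_form
proof
  show "ext_form x y = ext_form y x" for x y
    by (simp add: ext_form_def B_sym)
  show "bilinear ext_form"
    unfolding bilinear_def
    by (intro conjI allI linearI) (simp_all add: ext_form_def algebra_simps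
        linear_add[OF lin_B] linear_scale[OF lin_B] linear_add[OF linear_B2]
        linear_scale[OF linear_B2] linear_add[OF linear_pairing(1)]
        linear_scale[OF linear_pairing(1)] linear_add[OF linear_pairing(2)]
        linear_scale[OF linear_pairing(2)])
qed

lemma pairing_0: "pairing 0 v = 0" "pairing f 0 = 0"
  by (simp_all add: linear_0[OF linear_pairing(1)] linear_0[OF linear_pairing(2)])

lemma ext_form_lift [simp]: "ext_form (lift u) (lift v) = B u v"
  by (simp add: ext_form_def pairing_0)

lemma linear_lift: "linear (lift :: 'v \<Rightarrow> _)"
  by (intro linearI) auto

lemma span_lift: "span (lift ` A) = lift ` span A" for A :: "'v set"
  using linear_span_image[OF linear_lift] .

lemma expansion: "v = (\<Sum>s\<in>S. crd v s *\<^sub>R \<alpha> s)"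
proof -
  have "inj_on \<alpha> S" "independent (\<alpha> ` S)" "span (\<alpha> ` S) = UNIV"
    using basis by (auto simp: simple_root_basis_def)
  then have "v = (\<Sum>b\<in>\<alpha> ` S. representation (\<alpha> ` S) v b *\<^sub>R b)"
    using real_vector.sum_representation_eq[of "\<alpha> ` S" v "\<alpha> ` S"] fin by auto
  then show ?thesis
    using \<open>inj_on \<alpha> S\<close> by (simp add: sum.reindex coord_def)
qed

text \<open>This is what the extension is for: prescribed values on independent roots extend to a linear
  functional on \<open>V\<close>, which the second factor represents.\<close>

lemma dual_free_lift:
  assumes "independent A"
  shows "ext.dual_free (lift ` A)"
  unfolding ext.dual_free_def
proof
  fix d :: "'v \<times> 'v \<Rightarrow> real"
  obtain g :: "'v \<Rightarrow> real" where g: "linear g" "\<forall>v\<in>A. g v = d (lift v)"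
    using linear_independent_extend[OF assms, of "\<lambda>v. d (lift v)"] by auto
  define f where "f = (\<Sum>s\<in>S. g (\<alpha> s) *\<^sub>R \<alpha> s)"
  have crd_f: "crd f s = g (\<alpha> s)" if "s \<in> S" for s
  proof -
    have "crd f s = (\<Sum>r\<in>S. if r = s then g (\<alpha> r) else 0)"
      unfolding f_def linear_sum[OF lin_crd]
      using that by (intro sum.cong) (auto simp: linear_scale[OF lin_crd] crd_gen)
    then show ?thesis using that fin by simp
  qed
  have "pairing f v = g v" for v
  proof -
    have "g v = (\<Sum>s\<in>S. crd v s * g (\<alpha> s))"
      by (subst expansion[of v]) (simp add: linear_sum[OF g(1)] linear_scale[OF g(1)])
    then show ?thesis by (simp add: pairing_def crd_f mult.commute)
  qed
  then have "\<forall>b\<in>lift ` A. ext_form b (0, f) = d b"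
    using g(2) by (auto simp: ext_form_def pairing_0 linear_0[OF lin_B])
  then show "\<exists>z. \<forall>b\<in>lift ` A. ext_form b z = d b" by blast
qed

lemma reflect_involution: "ext_form a a = 1 \<Longrightarrow> ext.reflect a \<circ> ext.reflect a = id"
  by (simp add: ext.reflect_def fun_eq_iff ext.form_simps)

text \<open>The extended form has the same Gram matrix on the simple roots as \<open>B\<close>, and the
  relation \<open>(s t)\<^sup>m = 1\<close> for two reflections follows from this matrix alone.\<close>

lemma ext_reflect_power:
  assumes st: "s \<in> S" "t \<in> S"
  shows "(ext.reflect (lift (\<alpha> s)) \<circ> ext.reflect (lift (\<alpha> t))) ^^ cox_m W s t = id"
proof -
  consider "cox_m W s t = 0" | "cox_m W s t = 1" | "cox_m W s t > 1" by linarith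
  then show ?thesis
  proof cases
    case 2
    with cox_m_eq_1[OF cox fin basis st] st show ?thesis
      by (simp add: reflect_involution B_gen gram_self)
  next
    case 3
    define m where "m = cox_m W s t"
    define \<theta> where "\<theta> = pi / real m"
    have m: "m > 1" using 3 by (simp add: m_def)
    have "\<theta> > 0" "\<theta> < pi" using m by (simp_all add: \<theta>_def field_simps)
    then have sin: "sin \<theta> \<noteq> 0" using sin_gt_zero by force
    have m\<theta>: "real m * \<theta> = pi" using m by (simp add: \<theta>_def)
    have g: "gram W s t = - cos \<theta>" "gram W t s = - cos \<theta>"
      using m gram_sym[OF st] by (simp_all add: gram_def \<theta>_def m_def)
    have "ext.reflect b = (\<lambda>z. z - (2 * ext_form b z) *\<^sub>R b)" for b
      by (simp add: fun_eq_iff ext.reflect_def)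
    then have "((ext.reflect (lift (\<alpha> s)) \<circ> ext.reflect (lift (\<alpha> t))) ^^ m) z = z" for z
      using dihedral_power[of ext_form "lift (\<alpha> s)" "lift (\<alpha> t)" \<theta> m z] st sin m\<theta>
      by (simp add: ext.linear_form(1) B_gen g gram_self)
    then show ?thesis by (auto simp: m_def)
  qed simp
qed

abbreviation ext_word :: "'a list \<Rightarrow> 'v \<times> 'v \<Rightarrow> 'v \<times> 'v"
  where "ext_word u \<equiv> ext.reflect_prod (map (\<lambda>s. lift (\<alpha> s)) u)"

lemma ext_word_append: "ext_word (u @ v) = ext_word u \<circ> ext_word v"
  by (simp add: fun_eq_iff ext.reflect_prod_append)

lemma cox_eq_ext_word: "cox_eq W S u v \<Longrightarrow> ext_word u = ext_word v"
proof (induction rule: cox_eq.induct)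
  case (rel u v s t)
  have "ext_word (concat (replicate n [s, t])) =
      (ext.reflect (lift (\<alpha> s)) \<circ> ext.reflect (lift (\<alpha> t))) ^^ n" for n
    by (induction n) (auto simp: fun_eq_iff)
  then have "ext_word (concat (replicate (cox_m W s t) [s, t])) = id"
    using ext_reflect_power rel by simp
  then show ?case by (simp only: ext_word_append id_o o_id)
qed auto

definition ext_act :: "'a \<Rightarrow> 'v \<times> 'v \<Rightarrow> 'v \<times> 'v"
  where "ext_act w = ext_word (SOME u. u \<in> lists S \<and> wp u = w)"

lemma ext_act_wp:
  assumes "u \<in> lists S"
  shows "ext_act (wp u) = ext_word u"
proof -
  define v where "v = (SOME v. v \<in> lists S \<and> wp v = wp u)"
  have "v \<in> lists S \<and> wp v = wp u"
    unfolding v_def by (rule someI[of _ u]) (use assms in simp)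
  then have "cox_eq W S v u" using cox assms by (auto simp: coxeter_system_def)
  then show ?thesis unfolding ext_act_def v_def[symmetric] by (rule cox_eq_ext_word)
qed

lemma ext_act_one: "ext_act \<one> = id"
  using ext_act_wp[of "[]"] by (simp add: fun_eq_iff)

lemma ext_act_gen: "s \<in> S \<Longrightarrow> ext_act s = ext.reflect (lift (\<alpha> s))"
  using ext_act_wp[of "[s]"] by (simp add: fun_eq_iff)

lemma ext_act_mult:
  assumes "x \<in> carrier W" "y \<in> carrier W"
  shows "ext_act (x \<otimes> y) = ext_act x \<circ> ext_act y"
proof -
  obtain u v where uv: "u \<in> lists S" "wp u = x" "v \<in> lists S" "wp v = y"
    using assms by (metis ex_reduced_word)
  then have "ext_act (wp u \<otimes> wp v) = ext_word (u @ v)"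
    using ext_act_wp[of "u @ v"] by (simp only: wp_append append_in_lists_conv simp_thms)
  also have "\<dots> = ext_act x \<circ> ext_act y"
    unfolding ext_word_append using uv ext_act_wp by metis
  finally show ?thesis using uv by simp
qed

lemma linear_ext_act: "linear (ext_act w)"
  by (simp add: ext_act_def ext.linear_reflect_prod)

lemma ext_act_lift:
  assumes "w \<in> carrier W"
  shows "ext_act w (lift v) = lift (act w v)"
proof -
  obtain u where u: "u \<in> lists S" "wp u = w" using assms by (metis ex_reduced_word)
  have "ext_word u (lift v) = lift (word_act W S \<alpha> u v)"
    by (induction u) (auto simp: ext.reflect_def root_reflection_def)
  then show ?thesis using u act_wp ext_act_wp by metis
qed

lemma ext_act_isometry:
  assumes "w \<in> carrier W"
  shows "ext_form (ext_act w x) (ext_act w y) = ext_form x y"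
proof -
  obtain u where u: "u \<in> lists S" "wp u = w" using assms by (metis ex_reduced_word)
  have refl: "ext_form (ext.reflect b x) (ext.reflect b y) = ext_form x y"
    if "ext_form b b = 1" for b x y
    using that by (simp add: ext.reflect_def ext.form_simps ext.form_sym[of x b])
  have "u \<in> lists S \<Longrightarrow> ext_form (ext_word u x) (ext_word u y) = ext_form x y"
    by (induction u) (auto simp: refl B_gen gram_self)
  then show ?thesis using u ext_act_wp by metis
qed

section \<open>Reflections and their roots\<close>

abbreviation T :: "'a set" where "T \<equiv> reflections W S"
abbreviation root :: "'a \<Rightarrow> 'v" where "root \<equiv> refl_root W S \<alpha>"

lemma reflectionE:
  assumes "t \<in> T"
  obtains w s where "w \<in> carrier W" "s \<in> S" "t = w \<otimes> s \<otimes> inv w"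
  using assms by (auto simp: reflections_def)

lemma T_closed [simp]: "t \<in> T \<Longrightarrow> t \<in> carrier W"
  by (auto elim: reflectionE)

lemma gen_in_T: "s \<in> S \<Longrightarrow> s \<in> T"
  unfolding reflections_def by (intro CollectI exI[of _ \<one>] exI[of _ s]) simp

lemma T_conj: "w \<in> carrier W \<Longrightarrow> t \<in> T \<Longrightarrow> w \<otimes> t \<otimes> inv w \<in> T"
proof -
  assume w: "w \<in> carrier W" and t: "t \<in> T"
  from t obtain x s where x: "x \<in> carrier W" "s \<in> S" "t = x \<otimes> s \<otimes> inv x"
    by (rule reflectionE)
  then have "w \<otimes> t \<otimes> inv w = (w \<otimes> x) \<otimes> s \<otimes> inv (w \<otimes> x)"
    using w by (simp add: m_assoc inv_mult_group)
  moreover have "w \<otimes> x \<in> carrier W" using w x by simp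
  ultimately show ?thesis
    unfolding reflections_def using x(2) by (intro CollectI exI[of _ "w \<otimes> x"] exI[of _ s]) simp
qed

lemma T_invol: "t \<in> T \<Longrightarrow> t \<otimes> t = \<one>"
proof -
  assume "t \<in> T"
  then obtain x s where x: "x \<in> carrier W" "s \<in> S" "t = x \<otimes> s \<otimes> inv x"
    by (rule reflectionE)
  have "t \<otimes> t = x \<otimes> s \<otimes> (inv x \<otimes> x) \<otimes> s \<otimes> inv x"
    using x by (simp only: x(3) m_assoc m_closed inv_closed gen_closed)
  then show ?thesis using x by simp
qed

lemma T_inv: "t \<in> T \<Longrightarrow> inv t = t"
  using T_invol by (simp add: inv_equality)

lemma T_not_one: "\<one> \<notin> T"
proof
  assume "\<one> \<in> T"
  then obtain x s where x: "x \<in> carrier W" "s \<in> S" "\<one> = x \<otimes> s \<otimes> inv x"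
    by (rule reflectionE)
  then have "x \<otimes> s = x" by (metis gen_closed inv_closed inv_equality inv_inv m_closed)
  then have "s = \<one>" using x by simp
  moreover have "ord s = 2" using cox x by (simp add: coxeter_system_def)
  ultimately show False by simp
qed

lemma conj_ext_act:
  assumes w: "w \<in> carrier W" and s: "s \<in> S"
  shows "ext_act (w \<otimes> s \<otimes> inv w) = ext.reflect (lift (act w (\<alpha> s)))"
proof
  fix z
  define y where "y = ext_act (inv w) z"
  have y: "ext_act w y = z"
  proof -
    have "ext_act w \<circ> ext_act (inv w) = id" using w by (simp add: ext_act_one flip: ext_act_mult)
    then show ?thesis by (metis y_def comp_apply id_apply)
  qed
  have "ext_act (w \<otimes> s \<otimes> inv w) z = ext_act w (ext.reflect (lift (\<alpha> s)) y)"
    using w s by (simp add: ext_act_mult ext_act_gen y_def)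
  also have "\<dots> = z - (2 * ext_form (lift (\<alpha> s)) y) *\<^sub>R lift (act w (\<alpha> s))"
    by (simp only: ext.reflect_def linear_diff[OF linear_ext_act] linear_scale[OF linear_ext_act]
        y ext_act_lift[OF w])
  also have "ext_form (lift (\<alpha> s)) y = ext_form (lift (act w (\<alpha> s))) z"
    using ext_act_isometry[OF w, of "lift (\<alpha> s)" y] by (simp only: ext_act_lift[OF w] y)
  finally show "ext_act (w \<otimes> s \<otimes> inv w) z = ext.reflect (lift (act w (\<alpha> s))) z"
    by (simp only: ext.reflect_def)
qed

lemma root_norm: "\<beta> \<in> roots W S \<alpha> \<Longrightarrow> B \<beta> \<beta> = 1"
proof -
  assume "\<beta> \<in> roots W S \<alpha>"
  then obtain w s where w: "w \<in> carrier W" "s \<in> S" "\<beta> = act w (\<alpha> s)" by (auto simp: roots_def)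
  then show ?thesis
    using ext_act_isometry[OF w(1), of "lift (\<alpha> s)" "lift (\<alpha> s)"]
    by (simp add: ext_act_lift B_gen gram_self)
qed

text \<open>Two roots with the same reflection are proportional, and both have norm one; the sign is
  excluded by positivity.\<close>

lemma root_reflection_inj:
  assumes \<beta>: "\<beta> \<in> pos_roots W S \<alpha>" and \<gamma>: "\<gamma> \<in> pos_roots W S \<alpha>"
    and eq: "root_reflection W S \<alpha> \<beta> = root_reflection W S \<alpha> \<gamma>"
  shows "\<beta> = \<gamma>"
proof -
  have norm: "B \<beta> \<beta> = 1" "B \<gamma> \<gamma> = 1" using \<beta> \<gamma> by (auto simp: pos_roots_def root_norm)
  define r where "r = B \<gamma> \<beta>"
  have "\<beta> - 2 *\<^sub>R \<beta> = \<beta> - (2 * r) *\<^sub>R \<gamma>"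
    using fun_cong[OF eq, of \<beta>] by (simp add: root_reflection_def norm r_def)
  then have "2 *\<^sub>R \<beta> = 2 *\<^sub>R (r *\<^sub>R \<gamma>)" by simp
  then have b: "\<beta> = r *\<^sub>R \<gamma>" by (simp only: scaleR_cancel_left) simp
  have "B \<beta> (r *\<^sub>R \<gamma>) = r * r"
    using B_sym[of \<beta> \<gamma>] by (simp add: linear_scale[OF lin_B] r_def)
  then have "r * r = 1" using norm(1) b by metis
  then have "r = 1 \<or> r = - 1" by (simp add: square_eq_1_iff)
  moreover have "r \<noteq> - 1"
  proof
    assume "r = - 1"
    then have "crd \<beta> s = 0" if "s \<in> S" for s
      using b \<beta> \<gamma> that by (fastforce simp: pos_roots_def linear_neg[OF lin_crd])
    then have "\<beta> = 0" using expansion[of \<beta>] by simp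
    then show False using norm by (simp add: linear_0[OF lin_B])
  qed
  ultimately show ?thesis using b by auto
qed

text \<open>The root of \<open>w s w\<inverse>\<close> is \<open>w \<alpha>\<^sub>s\<close> up to sign, and the sign can be absorbed by replacing \<open>w\<close> with
  \<open>w s\<close>, which gives the same reflection.\<close>

lemma refl_root:
  assumes t: "t \<in> T"
  shows "act t = root_reflection W S \<alpha> (root t)"
    and "ext_act t = ext.reflect (lift (root t))"
    and "B (root t) (root t) = 1"
proof -
  obtain w s where w: "w \<in> carrier W" "s \<in> S" "t = w \<otimes> s \<otimes> inv w"
    using t by (rule reflectionE)
  obtain w' where w': "w' \<in> carrier W" "t = w' \<otimes> s \<otimes> inv w'" "nonneg (act w' (\<alpha> s))"
  proof (cases "nonneg (act w (\<alpha> s))")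
    case False
    have "act (w \<otimes> s) (\<alpha> s) = - act w (\<alpha> s)"
      using w by (simp add: act_mult act_gen_self linear_neg[OF linear_act])
    moreover have "w \<otimes> s \<otimes> s \<otimes> inv (w \<otimes> s) = t"
      using w S_inv[OF cox fin basis] by (simp add: inv_mult_group m_assoc)
    ultimately show thesis using that[of "w \<otimes> s"] root_sign[OF w(1,2)] False w by auto
  qed (use w that in auto)
  define \<gamma> where "\<gamma> = act w' (\<alpha> s)"
  have pos: "\<gamma> \<in> pos_roots W S \<alpha>"
    using w' w by (auto simp: \<gamma>_def pos_roots_def nonneg_def roots_def)
  have ext: "ext_act t = ext.reflect (lift \<gamma>)"
    unfolding \<gamma>_def w'(2) using w' w by (intro conj_ext_act)
  have act: "act t = root_reflection W S \<alpha> \<gamma>"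
  proof
    fix v
    have "lift (act t v) = ext.reflect (lift \<gamma>) (lift v)"
      using ext_act_lift[of t v] t ext by simp
    then show "act t v = root_reflection W S \<alpha> \<gamma> v"
      by (simp add: ext.reflect_def root_reflection_def)
  qed
  have "root t = \<gamma>"
    unfolding refl_root_def
    by (rule the_equality) (use pos act root_reflection_inj in auto)
  then show "act t = root_reflection W S \<alpha> (root t)" "ext_act t = ext.reflect (lift (root t))"
    "B (root t) (root t) = 1"
    using act ext pos root_norm by (auto simp: pos_roots_def)
qed

lemma wp_T_closed [simp]: "ts \<in> lists T \<Longrightarrow> wp ts \<in> carrier W"
  by (intro word_prod_closed is_group) auto

lemma wp_T_append: "us \<in> lists T \<Longrightarrow> vs \<in> lists T \<Longrightarrow> wp (us @ vs) = wp us \<otimes> wp vs"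
  by (intro word_prod_append is_group) auto

abbreviation ext_roots :: "'a list \<Rightarrow> ('v \<times> 'v) list"
  where "ext_roots ts \<equiv> map (\<lambda>t. lift (root t)) ts"

lemma ext_act_wp_T: "ts \<in> lists T \<Longrightarrow> ext_act (wp ts) = ext.reflect_prod (ext_roots ts)"
  by (induction ts) (auto simp: ext_act_one ext_act_mult refl_root(2) fun_eq_iff)

section \<open>Reflection length and the absolute order\<close>

abbreviation rlen :: "'a \<Rightarrow> nat" where "rlen \<equiv> refl_length W S"

lemma rlen_le: "ts \<in> lists T \<Longrightarrow> rlen (wp ts) \<le> length ts"
  unfolding refl_length_def by (rule Least_le) blast

lemma ex_T_reduced:
  assumes "w \<in> carrier W"
  obtains ts where "ts \<in> lists T" "length ts = rlen w" "wp ts = w"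
proof -
  obtain u where "u \<in> lists S" "wp u = w" using assms by (metis ex_reduced_word)
  moreover have "u \<in> lists T" using \<open>u \<in> lists S\<close> gen_in_T by auto
  ultimately have "\<exists>k. \<exists>ts\<in>lists T. length ts = k \<and> wp ts = w" by blast
  then have "\<exists>ts\<in>lists T. length ts = rlen w \<and> wp ts = w"
    unfolding refl_length_def by (rule LeastI_ex)
  then show thesis using that by blast
qed

lemma rlen_mult:
  assumes "x \<in> carrier W" "y \<in> carrier W"
  shows "rlen (x \<otimes> y) \<le> rlen x + rlen y"
proof -
  obtain us vs where "us \<in> lists T" "length us = rlen x" "wp us = x"
    "vs \<in> lists T" "length vs = rlen y" "wp vs = y"
    using assms by (metis ex_T_reduced)
  then show ?thesis using rlen_le[of "us @ vs"] by (simp add: wp_T_append)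
qed

lemma mult_inv_cancel [simp]:
  "x \<in> carrier W \<Longrightarrow> y \<in> carrier W \<Longrightarrow> x \<otimes> (inv x \<otimes> y) = y"
  by (simp flip: m_assoc)

lemma rlen_triangle:
  assumes "x \<in> carrier W" "y \<in> carrier W"
  shows "rlen y \<le> rlen x + rlen (inv x \<otimes> y)"
  using rlen_mult[of x "inv x \<otimes> y"] assms by simp

lemma rlen_reflection: "t \<in> T \<Longrightarrow> rlen t = 1"
proof -
  assume t: "t \<in> T"
  obtain ts where ts: "ts \<in> lists T" "length ts = rlen t" "wp ts = t"
    using t T_closed by (meson ex_T_reduced)
  have "ts \<noteq> []" using ts(3) t T_not_one by auto
  then have "rlen t \<noteq> 0" using ts(2) by (metis length_0_conv)
  moreover have "rlen t \<le> 1" using rlen_le[of "[t]"] t by simp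
  ultimately show ?thesis by simp
qed

lemma abs_le_trans:
  assumes car: "x \<in> carrier W" "y \<in> carrier W" "z \<in> carrier W"
    and le: "abs_le W S x y" "abs_le W S y z"
  shows "abs_le W S x z"
proof -
  have "inv x \<otimes> z = (inv x \<otimes> y) \<otimes> (inv y \<otimes> z)" using car by (simp add: m_assoc)
  then have "rlen (inv x \<otimes> z) \<le> rlen (inv x \<otimes> y) + rlen (inv y \<otimes> z)"
    using rlen_mult[of "inv x \<otimes> y" "inv y \<otimes> z"] car by simp
  then show ?thesis using le rlen_triangle[of x z] car by (simp add: abs_le_def)
qed

lemma refl_below_mono:
  assumes "x \<in> carrier W" "y \<in> carrier W" "abs_le W S x y"
  shows "refl_below W S x \<subseteq> refl_below W S y"
proof
  fix t assume "t \<in> refl_below W S x"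
  then have t: "t \<in> T" "abs_le W S t x" by (simp_all add: refl_below_def)
  then have "abs_le W S t y" using assms abs_le_trans[of t x y] by simp
  with t show "t \<in> refl_below W S y" by (simp add: refl_below_def)
qed

lemma conj_word:
  assumes "t \<in> T" "us \<in> lists T"
  shows "wp (map (\<lambda>r. t \<otimes> r \<otimes> t) us) = t \<otimes> wp us \<otimes> t"
  using assms(2)
proof (induction us)
  case Nil
  show ?case using assms by (simp add: T_invol)
next
  case (Cons r us)
  then have "wp (map (\<lambda>r. t \<otimes> r \<otimes> t) (r # us)) = t \<otimes> r \<otimes> (t \<otimes> t) \<otimes> wp us \<otimes> t"
    using assms(1) by (simp add: m_assoc)
  then show ?case using assms(1) Cons by (simp add: T_invol m_assoc)
qed

text \<open>A letter \<open>t\<close> of a reduced word can be moved to the front by conjugating the letters before it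
  with \<open>t\<close>, which keeps the length.\<close>

lemma letter_below:
  assumes ts: "ts \<in> lists T" "length ts = rlen (wp ts)" and t: "t \<in> set ts"
  shows "t \<in> refl_below W S (wp ts)"
proof -
  obtain us vs where split: "ts = us @ t # vs" using t by (meson split_list)
  have mem: "t \<in> T" "us \<in> lists T" "vs \<in> lists T" using ts split by auto
  define us' where "us' = map (\<lambda>r. t \<otimes> r \<otimes> t) us"
  have us': "us' \<in> lists T" using mem T_conj[of t] T_inv by (auto simp: us'_def)
  have "inv t \<otimes> wp ts = wp (us' @ vs)"
    using mem us' conj_word[of t us]
    by (simp add: split wp_T_append T_inv m_assoc us'_def)
  then have "rlen (inv t \<otimes> wp ts) \<le> length us + length vs"
    using rlen_le[of "us' @ vs"] us' mem by (simp add: us'_def)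
  moreover have "length ts = length us + length vs + 1" by (simp add: split)
  ultimately show ?thesis
    using ts mem rlen_triangle[of t "wp ts"] rlen_reflection[of t]
    by (simp add: refl_below_def abs_le_def)
qed

text \<open>A generator \<open>t \<in> T(x)\<close> moves vectors along its root, which lies in \<open>AM(x)\<close>.\<close>

lemma par_subgroup_moves:
  assumes "g \<in> par_subgroup W S x"
  shows "act g v - v \<in> abs_moved_space W S \<alpha> x"
  using assms unfolding par_subgroup_def
proof (induction arbitrary: v)
  case one
  show ?case by (simp add: act_one abs_moved_space_def span_zero)
next
  case (incl t)
  then have "t \<in> T" "root t \<in> abs_moved_space W S \<alpha> x"
    by (auto simp: refl_below_def abs_moved_space_def intro: span_base)
  then show ?case
    by (simp add: refl_root(1) root_reflection_def abs_moved_space_def span_neg span_scale)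
next
  case (inv t)
  then have "t \<in> T" "root t \<in> abs_moved_space W S \<alpha> x"
    by (auto simp: refl_below_def abs_moved_space_def intro: span_base)
  then show ?case
    by (simp add: T_inv refl_root(1) root_reflection_def abs_moved_space_def span_neg span_scale)
next
  case (eng g h)
  have "refl_below W S x \<subseteq> carrier W" by (auto simp: refl_below_def)
  then have "g \<in> carrier W" "h \<in> carrier W"
    using eng.hyps generate_in_carrier by blast+
  then have "act (g \<otimes> h) v - v = (act g (act h v) - act h v) + (act h v - v)"
    by (simp add: act_mult)
  then show ?case
    using eng.IH unfolding abs_moved_space_def by (metis span_add)
qed

text \<open>A reflection \<open>t \<in> P(x)\<close> maps its root to the negative, so it moves the root by \<open>- 2\<close> times
  itself, and this multiple lies in \<open>AM(x)\<close>.\<close>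

lemma abs_moved_space_par_subgroup:
  "abs_moved_space W S \<alpha> x = span (root ` (T \<inter> par_subgroup W S x))"
proof
  show "abs_moved_space W S \<alpha> x \<subseteq> span (root ` (T \<inter> par_subgroup W S x))"
    unfolding abs_moved_space_def par_subgroup_def
    by (intro span_mono image_mono) (auto simp: refl_below_def intro: generate.incl)
  have "root t \<in> abs_moved_space W S \<alpha> x" if t: "t \<in> T" "t \<in> par_subgroup W S x" for t
  proof -
    have "(- 2) *\<^sub>R root t \<in> abs_moved_space W S \<alpha> x"
      using par_subgroup_moves[OF t(2), of "root t"] t(1)
      by (simp add: refl_root root_reflection_def)
    then have "(- 1 / 2) *\<^sub>R (- 2) *\<^sub>R root t \<in> abs_moved_space W S \<alpha> x"
      unfolding abs_moved_space_def by (rule span_scale)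
    then show ?thesis by simp
  qed
  then show "span (root ` (T \<inter> par_subgroup W S x)) \<subseteq> abs_moved_space W S \<alpha> x"
    by (intro span_minimal) (auto simp: abs_moved_space_def)
qed

end


section \<open>Factorizations of a Coxeter element\<close>

locale coxeter_with_element = geometric_coxeter W S \<alpha>
  for W :: "('a, 'b) monoid_scheme" (structure) and S and \<alpha> :: "'a \<Rightarrow> 'v::real_vector" +
  fixes c assumes c: "coxeter_element W S c"
begin

lemma range_ext_act_c: "range (\<lambda>z. ext_act c z - z) = lift ` UNIV"
proof -
  obtain ss where ss: "distinct ss" "set ss = S" "c = wp ss"
    using c by (auto simp: coxeter_element_def)
  have basis': "inj_on \<alpha> S" "independent (\<alpha> ` S)" "span (\<alpha> ` S) = UNIV"
    using basis by (auto simp: simple_root_basis_def)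
  define bs where "bs = map (\<lambda>s. lift (\<alpha> s)) ss"
  have bs: "set bs = lift ` \<alpha> ` S" by (auto simp: bs_def ss(2))
  have "distinct bs"
    using ss basis' by (auto simp: bs_def distinct_map inj_on_def)
  moreover have "ext_act c = ext.reflect_prod bs"
    using ss ext_act_wp[of ss] by (auto simp: bs_def)
  ultimately show ?thesis
    using ext.reflect_prod_moved_space[of bs] dual_free_lift[OF basis'(2)]
    by (simp add: bs span_lift basis'(3))
qed

text \<open>The roots of the factorization span everything that \<open>c\<close> moves, which is all of \<open>V\<close>. A spanning
  family has at least as many members as a basis, and is independent if it has equally many.\<close>

lemma factorization_c:
  assumes ts: "ts \<in> lists T" "wp ts = c"
  shows "card S \<le> length ts"
    and "length ts = card S \<Longrightarrow> distinct (ext_roots ts) \<and> ext.dual_free (set (ext_roots ts))"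
proof -
  have basis': "inj_on \<alpha> S" "independent (\<alpha> ` S)"
    using basis by (auto simp: simple_root_basis_def)
  define R where "R = set (map root ts)"
  have R: "set (ext_roots ts) = lift ` R" by (auto simp: R_def)
  have "v \<in> span R" for v
  proof -
    have "lift v \<in> range (\<lambda>z. ext_act c z - z)" by (simp add: range_ext_act_c)
    then obtain z where "lift v = ext_act c z - z" by (rule rangeE)
    moreover have "ext_act c z - z \<in> span (set (ext_roots ts))"
      using ext.reflect_prod_moves_in_span[of "ext_roots ts" z] ext_act_wp_T[OF ts(1)] ts(2) by simp
    ultimately have "lift v \<in> lift ` span R" by (simp only: R span_lift)
    then show ?thesis by auto
  qed
  then have span: "span R = UNIV" by auto
  have n_le: "card S \<le> card A" if "finite A" "span A = UNIV" for A :: "'v set"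
    using real_vector.independent_span_bound[OF that(1) basis'(2)] that(2) basis'(1)
    by (simp add: card_image)
  have R_le: "card R \<le> length ts" using card_length[of "map root ts"] by (simp add: R_def)
  then show "card S \<le> length ts" using n_le[of R] span by (simp add: R_def)
  assume len: "length ts = card S"
  then have "card R = length (map root ts)" using n_le[of R] span R_le by (simp add: R_def)
  then have dist: "distinct (map root ts)" by (intro card_distinct) (simp add: R_def)
  obtain A where A: "A \<subseteq> R" "independent A" "R \<subseteq> span A"
    using real_vector.maximal_independent_subset[of R] by blast
  have finR: "finite R" by (simp add: R_def)
  have "span A = UNIV"
    using A(3) span span_minimal[OF A(3) subspace_span] by auto
  then have "card R \<le> card A" using n_le[of A] A(1) finR R_le len by (auto simp: finite_subset)
  then have "A = R" using A(1) finR by (meson card_seteq)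
  then show "distinct (ext_roots ts) \<and> ext.dual_free (set (ext_roots ts))"
    using A(2) dist dual_free_lift[of R] unfolding R by (auto simp: distinct_map inj_on_def)
qed

lemma c_closed: "c \<in> carrier W"
  using c word_prod_closed[OF is_group] S_car by (auto simp: coxeter_element_def)

lemma rlen_c: "rlen c = card S"
proof -
  obtain ss where ss: "distinct ss" "set ss = S" "c = wp ss"
    using c by (auto simp: coxeter_element_def)
  have "rlen c \<le> card S"
    using rlen_le[of ss] ss gen_in_T distinct_card[of ss] by auto
  moreover have "card S \<le> rlen c"
    using c_closed factorization_c(1) by (metis ex_T_reduced)
  ultimately show ?thesis by simp
qed

lemma below_c_free:
  assumes x: "x \<in> abs_interval W S c" and xs: "xs \<in> lists T" "length xs = rlen x" "wp xs = x"
  obtains ys where "ys \<in> lists T" "wp (xs @ ys) = c"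
    "distinct (ext_roots (xs @ ys))" "ext.dual_free (set (ext_roots (xs @ ys)))"
proof -
  have xc: "x \<in> carrier W" "abs_le W S x c" using x by (auto simp: abs_interval_def)
  obtain ys where ys: "ys \<in> lists T" "length ys = rlen (inv x \<otimes> c)" "wp ys = inv x \<otimes> c"
    using ex_T_reduced[of "inv x \<otimes> c"] xc c_closed by auto
  have prod: "wp (xs @ ys) = c" using xs ys xc c_closed by (simp add: wp_T_append)
  have "length (xs @ ys) = card S"
    using xs ys xc rlen_c by (simp add: abs_le_def)
  then have "distinct (ext_roots (xs @ ys)) \<and> ext.dual_free (set (ext_roots (xs @ ys)))"
    using factorization_c(2)[of "xs @ ys"] xs ys prod by simp
  then show thesis using that ys prod by blast
qed

lemma moved_space_below_c:
  assumes x: "x \<in> abs_interval W S c" and xs: "xs \<in> lists T" "length xs = rlen x" "wp xs = x"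
  shows "range (\<lambda>z. ext_act x z - z) = lift ` span (root ` set xs)"
proof -
  obtain ys where ys: "ys \<in> lists T" "wp (xs @ ys) = c"
    "distinct (ext_roots (xs @ ys))" "ext.dual_free (set (ext_roots (xs @ ys)))"
    using below_c_free[OF assms] .
  then have "distinct (ext_roots xs)" by simp
  moreover have "ext.dual_free (set (ext_roots xs))"
    using ys(4) by (rule ext.dual_free_subset) auto
  ultimately have "range (\<lambda>z. ext_act x z - z) = span (set (ext_roots xs))"
    using ext.reflect_prod_moved_space[of "ext_roots xs"] ext_act_wp_T[OF xs(1)] xs(3) by simp
  also have "set (ext_roots xs) = lift ` root ` set xs" by auto
  finally show ?thesis by (simp only: span_lift)
qed

abbreviation AM :: "'a \<Rightarrow> 'v set" where "AM \<equiv> abs_moved_space W S \<alpha>"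

text \<open>If \<open>t \<le>\<^sub>T x\<close>, then \<open>x\<close> has a reduced factorization that starts with \<open>t\<close>. The span of the roots
  is the same for all reduced factorizations of \<open>x\<close>, being the moved space of \<open>x\<close>.\<close>

lemma abs_moved_space_reduced:
  assumes x: "x \<in> abs_interval W S c" and xs: "xs \<in> lists T" "length xs = rlen x" "wp xs = x"
  shows "AM x = span (root ` set xs)"
proof
  have "set xs \<subseteq> refl_below W S x" using letter_below[of xs] xs by auto
  then show "span (root ` set xs) \<subseteq> AM x"
    unfolding abs_moved_space_def by (intro span_mono image_mono)
  have "root t \<in> span (root ` set xs)" if t: "t \<in> refl_below W S x" for t
  proof -
    have xc: "x \<in> carrier W" using x by (simp add: abs_interval_def)
    have tT: "t \<in> T" "abs_le W S t x" using t by (auto simp: refl_below_def)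
    obtain zs where zs: "zs \<in> lists T" "length zs = rlen (inv t \<otimes> x)" "wp zs = inv t \<otimes> x"
      using ex_T_reduced[of "inv t \<otimes> x"] xc tT by auto
    have "wp (t # zs) = x" "length (t # zs) = rlen x"
      using zs xc tT rlen_reflection[of t] by (auto simp: abs_le_def)
    then have "lift ` span (root ` set (t # zs)) = lift ` span (root ` set xs)"
      using moved_space_below_c[OF x, of "t # zs"] moved_space_below_c[OF x xs] zs tT by simp
    moreover have "root t \<in> span (root ` set (t # zs))" by (intro span_base) simp
    ultimately show ?thesis by auto
  qed
  then show "AM x \<subseteq> span (root ` set xs)"
    unfolding abs_moved_space_def by (intro span_minimal) auto
qed

theorem inj_on_abs_moved_space: "inj_on AM (abs_interval W S c)"
proof (rule inj_onI)
  fix x y assume x: "x \<in> abs_interval W S c" and y: "y \<in> abs_interval W S c" and eq: "AM x = AM y"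
  have car: "x \<in> carrier W" "y \<in> carrier W" using x y by (auto simp: abs_interval_def)
  obtain xs where xs: "xs \<in> lists T" "length xs = rlen x" "wp xs = x"
    using car(1) by (rule ex_T_reduced)
  obtain ys where ys: "ys \<in> lists T" "length ys = rlen y" "wp ys = y"
    using car(2) by (rule ex_T_reduced)
  obtain xs' where xs': "xs' \<in> lists T" "wp (xs @ xs') = c"
    "distinct (ext_roots (xs @ xs'))" "ext.dual_free (set (ext_roots (xs @ xs')))"
    using below_c_free[OF x xs] .
  obtain ys' where ys': "ys' \<in> lists T" "wp (ys @ ys') = c"
    "distinct (ext_roots (ys @ ys'))" "ext.dual_free (set (ext_roots (ys @ ys')))"
    using below_c_free[OF y ys] .
  have span_eq: "span (set (ext_roots zs)) = lift ` span (root ` set zs)" for zs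
  proof -
    have "set (ext_roots zs) = lift ` root ` set zs" by auto
    then show ?thesis by (simp only: span_lift)
  qed
  have "ext.reflect_prod (ext_roots xs) = ext.reflect_prod (ext_roots ys)"
  proof (rule ext.factor_determined_by_span[of _ "ext_roots xs'" _ "ext_roots ys'"])
    show "ext.reflect_prod (ext_roots xs @ ext_roots xs') =
        ext.reflect_prod (ext_roots ys @ ext_roots ys')"
      using ext_act_wp_T[of "xs @ xs'"] ext_act_wp_T[of "ys @ ys'"] xs xs' ys ys' by simp
    show "span (set (ext_roots xs)) = span (set (ext_roots ys))"
      using abs_moved_space_reduced[OF x xs] abs_moved_space_reduced[OF y ys] eq
      by (simp only: span_eq)
  qed (use xs' ys' in simp_all)
  then have "ext_act x = ext_act y" using ext_act_wp_T xs ys by metis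
  then have "act x = act y" using ext_act_lift car by (metis ext prod.inject)
  then have "act (inv x \<otimes> y) = act (inv x \<otimes> x)" using car by (simp only: act_mult inv_closed)
  then have "inv x \<otimes> y = \<one>" using car by (intro act_faithful) (simp_all add: act_one)
  then show "x = y" using car by (metis mult_inv_cancel r_one)
qed

end

theorem theorem1p1:
  fixes W :: "('a, 'b) monoid_scheme" and S :: "'a set" and c :: 'a
    and \<alpha> :: "'a \<Rightarrow> 'v::real_vector"
  assumes "coxeter_system W S" and "finite S" and "coxeter_element W S c"
    and "simple_root_basis S \<alpha>"
  shows "(abs_moved_space W S \<alpha> \<in> abs_interval W S c \<rightarrow> {U. subspace U} \<and>
      monotone_on (abs_interval W S c) (abs_le W S) (\<subseteq>) (abs_moved_space W S \<alpha>) \<and>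
      inj_on (abs_moved_space W S \<alpha>) (abs_interval W S c)) \<and>
    (par_subgroup W S \<in> abs_interval W S c \<rightarrow> refl_subgroups W S \<and>
      monotone_on (abs_interval W S c) (abs_le W S) (\<subseteq>) (par_subgroup W S) \<and>
      inj_on (par_subgroup W S) (abs_interval W S c)) \<and>
    (refl_below W S \<in> abs_interval W S c \<rightarrow> Pow (reflections W S) \<and>
      monotone_on (abs_interval W S c) (abs_le W S) (\<subseteq>) (refl_below W S) \<and>
      inj_on (refl_below W S) (abs_interval W S c))"
proof -
  interpret coxeter_with_element W S \<alpha> c
    using assms by unfold_locales
  let ?I = "abs_interval W S c"
  have mono: "refl_below W S x \<subseteq> refl_below W S y"
    if "x \<in> ?I" "y \<in> ?I" "abs_le W S x y" for x y
    using that refl_below_mono by (simp add: abs_interval_def)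
  have inj_P: "inj_on (par_subgroup W S) ?I"
  proof (rule inj_onI)
    fix x y assume "x \<in> ?I" "y \<in> ?I" "par_subgroup W S x = par_subgroup W S y"
    then show "x = y"
      using inj_onD[OF inj_on_abs_moved_space, of x y] abs_moved_space_par_subgroup[of x]
        abs_moved_space_par_subgroup[of y] by simp
  qed
  have inj_T: "inj_on (refl_below W S) ?I"
  proof (rule inj_onI)
    fix x y assume "x \<in> ?I" "y \<in> ?I" "refl_below W S x = refl_below W S y"
    then show "x = y"
      using inj_onD[OF inj_on_abs_moved_space, of x y] by (simp add: abs_moved_space_def)
  qed
  have AM: "abs_moved_space W S \<alpha> \<in> ?I \<rightarrow> {U. subspace U}"
    by (auto simp: abs_moved_space_def)
  have mono_AM: "monotone_on ?I (abs_le W S) (\<subseteq>) (abs_moved_space W S \<alpha>)"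
    unfolding abs_moved_space_def using mono by (intro monotone_onI span_mono image_mono)
  have T: "refl_below W S \<in> ?I \<rightarrow> Pow (reflections W S)"
    by (auto simp: refl_below_def)
  have P: "par_subgroup W S \<in> ?I \<rightarrow> refl_subgroups W S"
    unfolding par_subgroup_def refl_subgroups_def using T by blast
  have mono_P: "monotone_on ?I (abs_le W S) (\<subseteq>) (par_subgroup W S)"
    unfolding par_subgroup_def using mono by (intro monotone_onI mono_generate)
  have mono_T: "monotone_on ?I (abs_le W S) (\<subseteq>) (refl_below W S)"
    using mono by (intro monotone_onI)
  show ?thesis
    by (intro conjI AM P T mono_AM mono_P mono_T inj_on_abs_moved_space inj_P inj_T)
qed

end
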